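(* For every $\star\in\{D,V,E,F\}$ the approximation of the integral of the regularized integrand $\tilde k_{2,\star}$ over the unit cube by means of tensor Gauss quadrature converges exponentially with respect to the number $n$ of Gauss points per dimension: $$\left|E^n[\tilde k_{2,\star}]\right|\le C\,h^{3-2s}\,(2\rho_\star)^{-2n}$$ with $\rho_\star>1/2$, where $C>0$ and $\rho_\star$ are independent of $n$ and of the mesh size $h$. Here $V,E,F$ refer to a tetrahedron $t$ and a panel $\tau$ with a common vertex, with a common edge, and with $\tau$ a face of $t$, respectively, and $D$ to $t,\tau$ with positive distance comparable to $h$.
   Context: **Meshes.** $0<s<1$; $\Omega\subset\mathbb R^3$ is a Lipschitz domain with regular partitions $\mathcal T$ into tetrahedra; $\mathcal P$ is the set of all faces (panels) of the tetrahedra. $\varphi_1,\dots,\varphi_N$ is the nodal basis (one function per inner node) of the continuous piecewise linear functions on $\mathcal T$ vanishing outside $\Omega$. $h_t$ is the diameter of $t$ and $h$ the mean of all $h_t$, $t\in\mathcal T$. Shape regularity: the minimal interior angle of each $t\in\mathcal T$ is larger than $\theta_{\mathcal T}>0$. Quasi-uniformity: there are $c_1,c_2>0$ with $c_1h_{t_1}\le h_{t_2}\le c_2h_{t_1}$ for all $t_1,t_2\in\mathcal T$. The panels considered satisfy $\tau\subset\partial(\mathrm{supp}\,\varphi_i\cup\mathrm{supp}\,\varphi_j)$. **Geometric assumption.** (1) For all $t\in\mathcal T$ there are $c_A>0$ and $x_0\in\bar t$ such that $|x-y|\ge c_A(|x-x_0|+|x_0-y|)$ for all $x\in t$ and all $y\in\tau$,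 $\tau$ a panel of $\mathcal P$ away from $\bar t$ (printed: $y\in\tau\subset\mathcal P\setminus\bar t$). (2) For all $t\in\mathcal T$, $\tau\in\mathcal P$ whose intersection consists of a common vertex $p$ there is $c_A>0$ such that $|x-y|\ge c_A(|x-p|+|p-y|)$ for all $x\in t$, $y\in\tau$. (3) For all $t\in\mathcal T$, $\tau\in\mathcal P$ with exactly one common edge $S=\bar t\cap\bar\tau$ there are $c_A>0$ and a point $p\in S$ such that $|x-y|\ge c_A(|x-p|+|p-y|)$ for all $x\in t$, $y\in\tau$. (4) For all $t\in\mathcal T$, $\tau\in\mathcal P$ with exactly one common face $\bar t\cap\bar\tau=\bar\tau$ there are $c_A>0$ and a point $p\in\bar\tau$ such that $|x-y|\ge c_A(|x-p|+|p-y|)$ for all $x\in t$, $y\in\tau$. **Reference maps.** For a tetrahedron $t$ with vertices $a_t,b_t,c_t,d_t$: $\chi_t(\tilde x)=M_t\tilde x+a_t$, $M_t=[b_t-a_t,c_t-b_t,d_t-b_t]$, mapping $\{\tilde x\in\mathbb R^3:0\le\tilde x_1\le1,\ 0\le\tilde x_2\le\tilde x_1,\ 0\le\tilde x_3\le\tilde x_1-\tilde x_2\}$ onto $t$. For a panel $\tau$ with vertices $a_\tau,b_\tau,c_\tau$: $\chi_\tau(\tilde y)=M_\tau\tilde y+a_\tau$, $M_\tau=[b_\tau-a_\tau,c_\tau-b_\tau]$, mapping $\{\tilde y\in\mathbb R^2:0\le\tilde y_2\le\tilde y_1\le1\}$ onto $\tau$. The vertices are ordered so that common ones come first, in the same order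 (V: $a_t=a_\tau$; E: also $b_t=b_\tau$; F: also $c_t=c_\tau$). $\lambda_i^t$ is the affine function on $\mathbb R^3$ coinciding with $\varphi_i$ on $t$; $n_\tau$ is the normal vector of $\tau$. For given indices $i,j$, $$\tilde k_2(\tilde x,\tilde y)=\lambda_i^t(\chi_t(\tilde x))\lambda_j^t(\chi_t(\tilde x))\frac{(\chi_\tau(\tilde y)-\chi_t(\tilde x))^Tn_\tau}{|\chi_\tau(\tilde y)-\chi_t(\tilde x)|^{3+2s}}|\det M_t|\,|(b_\tau-a_\tau)\times(c_\tau-b_\tau)|.$$ The integrands below arise by Duffy-type transformations from $$\int_t\varphi_i(x)\varphi_j(x)\int_\tau\frac{(y-x)^Tn_\tau}{|x-y|^{3+2s}}\,ds_y\,dx.$$ **Regularized integrands.** In the cases V, E, F, $\tilde k_{2,\star}(\eta)=\sum_m\tilde k_2(\mathscr D_m(\eta))J_m(\eta)$ with: (V, $\eta\in[0,1]^4$) $\mathscr D_1=((1,\eta_1\eta_2,\eta_1(1-\eta_2)),(\eta_3,\eta_3\eta_4))$, $\mathscr D_2=((\eta_2,\eta_2\eta_3\eta_4,\eta_2\eta_3(1-\eta_4)),(1,\eta_1))$; $J_1=\eta_1\eta_3$, $J_2=\eta_2^2\eta_3$. (E, $\eta\in[0,1]^3$) $\mathscr D_1=((0,\eta_1,1-\eta_1),(-\eta_2\eta_3,\eta_2(1-\eta_3)))$, $\mathscr D_2=((0,\eta_2\eta_3,\eta_2(1-\eta_3)),(-\eta_1,1-\eta_1))$, $\mathscr D_3=((-\eta_2\eta_3,\eta_2(1-\eta_3),1-\eta_2),(0,\eta_1))$,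 $\mathscr D_4=((-\eta_1\eta_2\eta_3,\eta_1\eta_2(1-\eta_3),\eta_1(1-\eta_2)),(0,1))$; $J_1=J_2=J_3=\eta_2$, $J_4=\eta_1^2\eta_2$. (F, $\eta\in[0,1]^2$) $\mathscr D_1=((0,\eta_1,1-\eta_1),(-\eta_1\eta_2,0))$, $\mathscr D_2=((0,\eta_1\eta_2,\eta_1(1-\eta_2)),(-1,0))$, $\mathscr D_3=((0,\eta_1\eta_2,1-\eta_1\eta_2),(-\eta_1,0))$, $\mathscr D_4=((0,0,1),(-\eta_1\eta_2,\eta_1(1-\eta_2)))$, $\mathscr D_5=((-\eta_1\eta_2,\eta_1(1-\eta_2),1-\eta_1),(0,0))$, $\mathscr D_6=((-\eta_1,0,1-\eta_1),(0,\eta_1\eta_2))$, $\mathscr D_7=((-\eta_1\eta_2,0,\eta_1(1-\eta_2)),(0,1))$, $\mathscr D_8=((-\eta_1\eta_2,0,1-\eta_1\eta_2),(0,\eta_1))$, $\mathscr D_9=((0,0,\eta_2),(-\eta_1,1-\eta_1))$; $J_m=\eta_1$ for $m\le8$, $J_9=1$. (D, $\eta\in[0,1]^5$) Here $d_{t,\tau}=\inf_{(x,y)\in t\times\tau}|x-y|>0$ and $d_{t,\tau}\approx h$, i.e. $c_3h\le d_{t,\tau}\le c_4h$ with fixed $c_3,c_4>0$. With $\mathscr D_1=(\eta_1,\eta_1\eta_2,\eta_1\eta_2\eta_3)$, $\mathscr D_2=(\eta_4,\eta_4\eta_5)$, $J=\eta_1^2\eta_2\eta_4$, $$\tilde k_{2,D}(\eta)=\varphi_i(\chi_t(\mathscr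 D_1))\,\varphi_j(\chi_t(\mathscr D_1))\,\frac{[\chi_\tau(\mathscr D_2)-\chi_t(\mathscr D_1)]^Tn_\tau}{|\chi_\tau(\mathscr D_2)-\chi_t(\mathscr D_1)|^{3+2s}}\,|\det M_t|\,|(b_\tau-a_\tau)\times(c_\tau-b_\tau)|\,J.$$ **Quadrature error.** For $g:[0,1]^k\to\mathbb C$, $E^n[g]=|I[g]-Q^n[g]|$, where $I[g]=\int_{[0,1]^k}g$ and $Q^n[g]$ is the tensor Gauss quadrature with $n$ points in each of the $k$ dimensions.
   Formalization: In case D the first Duffy map is corrected to (η1, η1η2η3, η1η2(1−η3)), since the printed (η1, η1η2, η1η2η3) leaves t, where φ_i has kinks; in the geometric assumption c_A is uniform, and in (3),(4) the point p may depend on x and y. *)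

theory Defs
  imports "HOL-Analysis.Analysis" "HOL-Computational_Algebra.Polynomial"
begin

section \<open>Domains and meshes\<close>

(* Near each boundary point, the domain lies on one side of the graph of a Lipschitz function
   over the hyperplane orthogonal to u. *)
definition lipschitz_domain :: "(real^3) set \<Rightarrow> bool" where
  "lipschitz_domain \<Omega> \<longleftrightarrow>
     open \<Omega> \<and> connected \<Omega> \<and> bounded \<Omega> \<and> \<Omega> \<noteq> {} \<and>
     (\<forall>p\<in>frontier \<Omega>. \<exists>r>0. \<exists>u L g. norm u = 1 \<and> L-lipschitz_on {z. z \<bullet> u = 0} g \<and>
        \<Omega> \<inter> ball p r = {x \<in> ball p r. x \<bullet> u > g (x - (x \<bullet> u) *\<^sub>R u)})"

(* All elements are closed sets here; triangulation says that any two of them meet in a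
   common (possibly empty) face. *)
definition regular_partition :: "(real^3) set \<Rightarrow> (real^3) set set \<Rightarrow> bool" where
  "regular_partition \<Omega> \<T> \<longleftrightarrow>
     triangulation \<T> \<and> (\<forall>t\<in>\<T>. 3 simplex t) \<and> \<Union>\<T> = closure \<Omega>"

definition panels :: "(real^3) set set \<Rightarrow> (real^3) set set" where
  "panels \<T> = {\<tau>. \<exists>t\<in>\<T>. \<tau> facet_of t}"

definition mesh_size :: "(real^3) set set \<Rightarrow> real" where
  "mesh_size \<T> = (\<Sum>t\<in>\<T>. diameter t) / real (card \<T>)"

definition vec_angle :: "real^3 \<Rightarrow> real^3 \<Rightarrow> real" where
  "vec_angle x y = arccos ((x \<bullet> y) / (norm x * norm y))"

definition reject_along :: "real^3 \<Rightarrow> real^3 \<Rightarrow> real^3" where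
  "reject_along e x = x - ((x \<bullet> e) / (e \<bullet> e)) *\<^sub>R e"

definition face_angles :: "(real^3) set \<Rightarrow> real set" where
  "face_angles t = {vec_angle (u - v) (w - v) | u v w.
     {u, v, w} \<subseteq> {p. p extreme_point_of t} \<and> distinct [u, v, w]}"

(* The angle at the edge u v between the faces u v w and u v z. *)
definition dihedral_angles :: "(real^3) set \<Rightarrow> real set" where
  "dihedral_angles t =
     {vec_angle (reject_along (v - u) (w - u)) (reject_along (v - u) (z - u)) | u v w z.
        {u, v, w, z} \<subseteq> {p. p extreme_point_of t} \<and> distinct [u, v, w, z]}"

(* Both kinds of angles are needed: slivers have large face angles and needles have large
   dihedral angles. *)
definition shape_regular :: "real \<Rightarrow> (real^3) set set \<Rightarrow> bool" where
  "shape_regular \<theta> \<T> \<longleftrightarrow> (\<forall>t\<in>\<T>. \<forall>\<alpha> \<in> face_angles t \<union> dihedral_angles t. \<theta> < \<alpha>)"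

definition quasi_uniform :: "real \<Rightarrow> real \<Rightarrow> (real^3) set set \<Rightarrow> bool" where
  "quasi_uniform c1 c2 \<T> \<longleftrightarrow>
     (\<forall>t1\<in>\<T>. \<forall>t2\<in>\<T>. c1 * diameter t1 \<le> diameter t2 \<and> diameter t2 \<le> c2 * diameter t1)"

(* One constant serves all pairs. In the last two parts the point p has to depend on x and y:
   a fixed p is impossible, since x and y may be the same point of the common edge or face. *)
definition geometric_assumption :: "real \<Rightarrow> (real^3) set set \<Rightarrow> bool" where
  "geometric_assumption cA \<T> \<longleftrightarrow>
     (\<forall>t\<in>\<T>. \<exists>x0\<in>t. \<forall>\<tau>\<in>panels \<T>. t \<inter> \<tau> = {} \<longrightarrow>
        (\<forall>x\<in>t. \<forall>y\<in>\<tau>. dist x y \<ge> cA * (dist x x0 + dist x0 y))) \<and>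
     (\<forall>t\<in>\<T>. \<forall>\<tau>\<in>panels \<T>. \<forall>p. t \<inter> \<tau> = {p} \<longrightarrow>
        (\<forall>x\<in>t. \<forall>y\<in>\<tau>. dist x y \<ge> cA * (dist x p + dist p y))) \<and>
     (\<forall>t\<in>\<T>. \<forall>\<tau>\<in>panels \<T>. (t \<inter> \<tau>) edge_of t \<and> (t \<inter> \<tau>) edge_of \<tau> \<longrightarrow>
        (\<forall>x\<in>t. \<forall>y\<in>\<tau>. \<exists>p\<in>t \<inter> \<tau>. dist x y \<ge> cA * (dist x p + dist p y))) \<and>
     (\<forall>t\<in>\<T>. \<forall>\<tau>\<in>panels \<T>. \<tau> facet_of t \<longrightarrow>
        (\<forall>x\<in>t. \<forall>y\<in>\<tau>. \<exists>p\<in>\<tau>. dist x y \<ge> cA * (dist x p + dist p y)))"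

section \<open>Finite element functions\<close>

definition inner_nodes :: "(real^3) set \<Rightarrow> (real^3) set set \<Rightarrow> (real^3) set" where
  "inner_nodes \<Omega> \<T> = {p \<in> \<Omega>. \<exists>t\<in>\<T>. p extreme_point_of t}"

definition fe_space :: "(real^3) set \<Rightarrow> (real^3) set set \<Rightarrow> (real^3 \<Rightarrow> real) set" where
  "fe_space \<Omega> \<T> = {v. continuous_on UNIV v \<and> (\<forall>t\<in>\<T>. \<exists>a b. \<forall>x\<in>t. v x = a \<bullet> x + b) \<and>
     (\<forall>x. x \<notin> \<Omega> \<longrightarrow> v x = 0)}"

definition nodal_basis ::
  "(real^3) set \<Rightarrow> (real^3) set set \<Rightarrow> nat \<Rightarrow> (nat \<Rightarrow> real^3 \<Rightarrow> real) \<Rightarrow> bool" where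
  "nodal_basis \<Omega> \<T> N \<phi> \<longleftrightarrow>
     (\<exists>z. bij_betw z {1..N} (inner_nodes \<Omega> \<T>) \<and>
        (\<forall>i\<in>{1..N}. \<phi> i \<in> fe_space \<Omega> \<T> \<and>
           (\<forall>k\<in>{1..N}. \<phi> i (z k) = (if k = i then 1 else 0))))"

definition supp :: "(real^3 \<Rightarrow> real) \<Rightarrow> (real^3) set" where
  "supp v = closure {x. v x \<noteq> 0}"

definition affine_extension :: "(real^3 \<Rightarrow> real) \<Rightarrow> (real^3) set \<Rightarrow> real^3 \<Rightarrow> real" where
  "affine_extension v t = (THE l. (\<exists>a b. l = (\<lambda>x. a \<bullet> x + b)) \<and> (\<forall>x\<in>t. l x = v x))"

section \<open>Reference maps and the transformed kernel\<close>

(* An ordered tuple of vertices (a,b,c,d) or (a,b,c) is a vector of points, P$1 = a, P$2 = b, ... *)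

definition conv :: "real^3^'k \<Rightarrow> (real^3) set" where
  "conv P = convex hull (range (($) P))"

(* vector [...] lists rows, so transpose turns the listed points into columns. *)
definition tet_matrix :: "real^3^4 \<Rightarrow> real^3^3" where
  "tet_matrix P = transpose (vector [P$2 - P$1, P$3 - P$2, P$4 - P$2])"

definition tet_map :: "real^3^4 \<Rightarrow> real^3 \<Rightarrow> real^3" where
  "tet_map P x = tet_matrix P *v x + P$1"

definition tri_matrix :: "real^3^3 \<Rightarrow> real^2^3" where
  "tri_matrix Q = transpose (vector [Q$2 - Q$1, Q$3 - Q$2] :: real^3^2)"

definition tri_map :: "real^3^3 \<Rightarrow> real^2 \<Rightarrow> real^3" where
  "tri_map Q y = tri_matrix Q *v y + Q$1"

definition unit_normal :: "(real^3) set \<Rightarrow> real^3 \<Rightarrow> bool" where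
  "unit_normal \<tau> \<nu> \<longleftrightarrow> norm \<nu> = 1 \<and> (\<forall>x\<in>\<tau>. \<forall>y\<in>\<tau>. (x - y) \<bullet> \<nu> = 0)"

(* f and g are the two shape functions, either globally or as affine extensions. *)
definition kernel2 :: "real \<Rightarrow> (real^3 \<Rightarrow> real) \<Rightarrow> (real^3 \<Rightarrow> real) \<Rightarrow>
    real^3^4 \<Rightarrow> real^3^3 \<Rightarrow> real^3 \<Rightarrow> real^3 \<Rightarrow> real^2 \<Rightarrow> real" where
  "kernel2 s f g P Q \<nu> x y =
     f (tet_map P x) * g (tet_map P x) *
     (((tri_map Q y - tet_map P x) \<bullet> \<nu>) / norm (tri_map Q y - tet_map P x) powr (3 + 2 * s)) *
     \<bar>det (tet_matrix P)\<bar> * norm (cross3 (Q$2 - Q$1) (Q$3 - Q$2))"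

section \<open>Regularized integrands\<close>

(* For x and y in disjoint sets: the unit cube is mapped onto the reference tetrahedron
   {x. 0 <= x1 <= 1, 0 <= x2 <= x1, 0 <= x3 <= x1 - x2} of tet_map, with Jacobian eta1^2 eta2;
   the image point under tet_map is
   (1 - eta1) a + eta1 (1 - eta2) b + eta1 eta2 eta3 c + eta1 eta2 (1 - eta3) d.
   The source prints (eta1, eta1 eta2, eta1 eta2 eta3), with the same Jacobian. This belongs to
   the other reference tetrahedron 0 <= x3 <= x2 <= x1 <= 1, with matrix [b-a, c-b, d-c], where
   it gives the same image point up to exchanging c and d; under tet_map it would leave the
   tetrahedron (eta = (1,1,1) goes to c + d - b). *)
definition integrand_D :: "(real^3 \<Rightarrow> real^2 \<Rightarrow> real) \<Rightarrow> real^5 \<Rightarrow> real" where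
  "integrand_D K \<eta> =
     K (vector [\<eta>$1, \<eta>$1 * \<eta>$2 * \<eta>$3, \<eta>$1 * \<eta>$2 * (1 - \<eta>$3)]) (vector [\<eta>$4, \<eta>$4 * \<eta>$5])
       * ((\<eta>$1)\<^sup>2 * \<eta>$2 * \<eta>$4)"

definition integrand_V :: "(real^3 \<Rightarrow> real^2 \<Rightarrow> real) \<Rightarrow> real^4 \<Rightarrow> real" where
  "integrand_V K \<eta> =
     K (vector [1, \<eta>$1 * \<eta>$2, \<eta>$1 * (1 - \<eta>$2)]) (vector [\<eta>$3, \<eta>$3 * \<eta>$4]) * (\<eta>$1 * \<eta>$3) +
     K (vector [\<eta>$2, \<eta>$2 * \<eta>$3 * \<eta>$4, \<eta>$2 * \<eta>$3 * (1 - \<eta>$4)]) (vector [1, \<eta>$1]) * ((\<eta>$2)\<^sup>2 * \<eta>$3)"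

(* In the edge and face cases the arguments are relative coordinates and may lie outside
   the reference elements. *)
definition integrand_E :: "(real^3 \<Rightarrow> real^2 \<Rightarrow> real) \<Rightarrow> real^3 \<Rightarrow> real" where
  "integrand_E K \<eta> =
     K (vector [0, \<eta>$1, 1 - \<eta>$1]) (vector [- \<eta>$2 * \<eta>$3, \<eta>$2 * (1 - \<eta>$3)]) * \<eta>$2 +
     K (vector [0, \<eta>$2 * \<eta>$3, \<eta>$2 * (1 - \<eta>$3)]) (vector [- \<eta>$1, 1 - \<eta>$1]) * \<eta>$2 +
     K (vector [- \<eta>$2 * \<eta>$3, \<eta>$2 * (1 - \<eta>$3), 1 - \<eta>$2]) (vector [0, \<eta>$1]) * \<eta>$2 +
     K (vector [- \<eta>$1 * \<eta>$2 * \<eta>$3, \<eta>$1 * \<eta>$2 * (1 - \<eta>$3), \<eta>$1 * (1 - \<eta>$2)]) (vector [0, 1])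
       * ((\<eta>$1)\<^sup>2 * \<eta>$2)"

definition integrand_F :: "(real^3 \<Rightarrow> real^2 \<Rightarrow> real) \<Rightarrow> real^2 \<Rightarrow> real" where
  "integrand_F K \<eta> =
     K (vector [0, \<eta>$1, 1 - \<eta>$1]) (vector [- \<eta>$1 * \<eta>$2, 0]) * \<eta>$1 +
     K (vector [0, \<eta>$1 * \<eta>$2, \<eta>$1 * (1 - \<eta>$2)]) (vector [- 1, 0]) * \<eta>$1 +
     K (vector [0, \<eta>$1 * \<eta>$2, 1 - \<eta>$1 * \<eta>$2]) (vector [- \<eta>$1, 0]) * \<eta>$1 +
     K (vector [0, 0, 1]) (vector [- \<eta>$1 * \<eta>$2, \<eta>$1 * (1 - \<eta>$2)]) * \<eta>$1 +
     K (vector [- \<eta>$1 * \<eta>$2, \<eta>$1 * (1 - \<eta>$2), 1 - \<eta>$1]) (vector [0, 0]) * \<eta>$1 +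
     K (vector [- \<eta>$1, 0, 1 - \<eta>$1]) (vector [0, \<eta>$1 * \<eta>$2]) * \<eta>$1 +
     K (vector [- \<eta>$1 * \<eta>$2, 0, \<eta>$1 * (1 - \<eta>$2)]) (vector [0, 1]) * \<eta>$1 +
     K (vector [- \<eta>$1 * \<eta>$2, 0, 1 - \<eta>$1 * \<eta>$2]) (vector [0, \<eta>$1]) * \<eta>$1 +
     K (vector [0, 0, \<eta>$2]) (vector [- \<eta>$1, 1 - \<eta>$1])"

section \<open>Tensor Gauss quadrature on the unit cube\<close>

(* Rodrigues' formula for the Legendre polynomials on [0,1]. *)
definition legendre01 :: "nat \<Rightarrow> real poly" where
  "legendre01 n = smult (1 / fact n) ((pderiv ^^ n) ([:0, - 1, 1:] ^ n))"

definition gauss_nodes :: "nat \<Rightarrow> real set" where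
  "gauss_nodes n = {x. poly (legendre01 n) x = 0}"

definition gauss_weight :: "nat \<Rightarrow> real \<Rightarrow> real" where
  "gauss_weight n x = integral {0..1} (\<lambda>y. \<Prod>z\<in>gauss_nodes n - {x}. (y - z) / (x - z))"

definition gauss_quadrature ::
  "nat \<Rightarrow> (real^'k \<Rightarrow> 'a::real_normed_vector) \<Rightarrow> 'a" where
  "gauss_quadrature n g =
     (\<Sum>x | \<forall>i. x$i \<in> gauss_nodes n. (\<Prod>i\<in>UNIV. gauss_weight n (x$i)) *\<^sub>R g x)"

definition quadrature_error ::
  "nat \<Rightarrow> (real^'k \<Rightarrow> 'a::real_normed_vector) \<Rightarrow> real" where
  "quadrature_error n g = norm (integral (cbox 0 1) g - gauss_quadrature n g)"

section \<open>The four cases\<close>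

datatype interaction = Distant | Vertex | Edge | Face

(* Relative position of conv P and conv Q, common vertices being listed first and in the same
   order; h is the mesh size. *)
fun configuration ::
  "interaction \<Rightarrow> real \<Rightarrow> real \<Rightarrow> real \<Rightarrow> real^3^4 \<Rightarrow> real^3^3 \<Rightarrow> bool" where
  "configuration Distant c3 c4 h P Q \<longleftrightarrow>
     0 < setdist (conv P) (conv Q) \<and>
     c3 * h \<le> setdist (conv P) (conv Q) \<and> setdist (conv P) (conv Q) \<le> c4 * h"
| "configuration Vertex c3 c4 h P Q \<longleftrightarrow>
     P$1 = Q$1 \<and> conv P \<inter> conv Q = {P$1}"
| "configuration Edge c3 c4 h P Q \<longleftrightarrow>
     P$1 = Q$1 \<and> P$2 = Q$2 \<and> conv P \<inter> conv Q = closed_segment (P$1) (P$2)"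
| "configuration Face c3 c4 h P Q \<longleftrightarrow>
     P$1 = Q$1 \<and> P$2 = Q$2 \<and> P$3 = Q$3 \<and> conv P \<inter> conv Q = conv Q"

(* f and g are the two nodal basis functions. *)
fun integrand_error :: "interaction \<Rightarrow> nat \<Rightarrow> real \<Rightarrow> (real^3 \<Rightarrow> real) \<Rightarrow> (real^3 \<Rightarrow> real) \<Rightarrow>
    real^3^4 \<Rightarrow> real^3^3 \<Rightarrow> real^3 \<Rightarrow> real" where
  "integrand_error Distant n s f g P Q \<nu> =
     quadrature_error n (integrand_D (kernel2 s f g P Q \<nu>))"
| "integrand_error Vertex n s f g P Q \<nu> =
     quadrature_error n (integrand_V
       (kernel2 s (affine_extension f (conv P)) (affine_extension g (conv P)) P Q \<nu>))"
| "integrand_error Edge n s f g P Q \<nu> =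
     quadrature_error n (integrand_E
       (kernel2 s (affine_extension f (conv P)) (affine_extension g (conv P)) P Q \<nu>))"
| "integrand_error Face n s f g P Q \<nu> =
     quadrature_error n (integrand_F
       (kernel2 s (affine_extension f (conv P)) (affine_extension g (conv P)) P Q \<nu>))"

end

theory Submission
  imports Defs
begin

text \<open>Up to a factor and a polynomial, every term of a regularized integrand is a power
  \<open>r powr (- (3 + 2 s) / 2)\<close>, where \<open>r\<close> is the squared distance of the two transformed points
  divided by a multiple of \<open>h\<^sup>2\<close>. This \<open>r\<close> is a polynomial of fixed degree with values in an interval
  \<open>[\<delta>, 1]\<close>, where \<open>\<delta> > 0\<close> depends only on the shape regularity, the quasi-uniformity and the geometric
  assumption. Truncating the binomial series of the power around \<open>1\<close> therefore gives polynomials that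
  converge to the integrand at a uniform exponential rate. The tensor Gauss rule has nonnegative
  weights of sum \<open>1\<close> and is exact for polynomials of degree at most \<open>2 n - 1\<close> in each variable, so its
  error is at most twice the error of best approximation. No analytic continuation is needed.\<close>

text \<open>The obstacle is uniformity: \<open>C\<close> and \<open>\<rho>\<close> must be fixed
  before the mesh, the pair of elements and \<open>n\<close>. Scaling settles most of it.
  Determinant, cross product and numerator contribute \<open>h^3\<close>, \<open>h^2\<close> and
  \<open>h\<close>, the denominator contributes the power \<open>-(3 + 2 s)\<close> of
  \<open>h\<close>, and together they give the power \<open>3 - 2 s\<close>; what remains is
  confined by scale-free constants. Only the lower bound \<open>\<delta>\<close> uses finer
  geometry. The Duffy transformations have cancelled the radial variable, so in every term the
  relative coordinates stay away from zero: with a common vertex, one of the two points lies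
  opposite to that vertex; with a common edge or face, the absolute differences of corresponding
  coordinates add up to at least one. Nondegenerate elements turn coordinates into lengths. With a
  common vertex or edge, the geometric assumption prevents the lengths coming from the two elements
  from cancelling each other. With a common face, both elements share one basis and no cancellation
  can occur.\<close>

section \<open>Derivatives and roots of real polynomials\<close>

text \<open>Each differentiation costs at most one factor \<open>p\<close>. Applied to
  \<open>x^2 - x\<close>, this makes the derivatives of order below \<open>n\<close> of its
  \<open>n\<close>-th power vanish at 0 and 1, which serves both Rolle's theorem and integration by
  parts.\<close>

lemma power_dvd_pderiv_iter:
  fixes p :: "'a :: idom poly"
  shows "k \<le> n \<Longrightarrow> p ^ (n - k) dvd (pderiv ^^ k) (p ^ n)"
proof (induction k)
  case (Suc k)
  then obtain r where r: "(pderiv ^^ k) (p ^ n) = p ^ (n - k) * r"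
    by (auto elim: dvdE)
  have "n - k = Suc (n - Suc k)"
    using Suc.prems by simp
  then have "(pderiv ^^ Suc k) (p ^ n)
      = p ^ (n - Suc k) * (p * pderiv r + smult (of_nat (Suc (n - Suc k))) (r * pderiv p))"
    by (simp add: r pderiv_mult pderiv_power_Suc del: of_nat_Suc power_Suc)
       (simp add: algebra_simps smult_add_right del: of_nat_Suc)
  then show ?case
    by (rule dvdI)
qed simp

lemma integral_pderiv:
  fixes p :: "real poly"
  assumes "a \<le> b"
  shows "integral {a..b} (poly (pderiv p)) = poly p b - poly p a"
proof -
  have "(poly (pderiv p) has_integral poly p b - poly p a) {a..b}"
    using assms
    by (intro fundamental_theorem_of_calculus)
       (auto simp: has_real_derivative_iff_has_vector_derivative[symmetric]
             intro: has_field_derivative_at_within poly_DERIV)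
  then show ?thesis
    by (rule integral_unique)
qed

lemma poly_integrable_on: "poly (p :: real poly) integrable_on {a..b}"
  by (intro integrable_continuous_real continuous_intros)

text \<open>Iterated Rolle. The induction removes the largest root; the new zero of the derivative
  lies above all remaining roots of \<open>p\<close> and hence differs from the zeros found
  before.\<close>

lemma pderiv_roots_between:
  fixes p :: "real poly"
  assumes "finite S" "card S = Suc m" "\<And>x. x \<in> S \<Longrightarrow> poly p x = 0"
  shows "\<exists>R. finite R \<and> card R = m \<and> R \<subseteq> {Min S<..<Max S} \<and> (\<forall>x\<in>R. poly (pderiv p) x = 0)"
  using assms
proof (induction m arbitrary: S)
  case 0
  then show ?case by (intro exI[of _ "{}"]) auto
next
  case (Suc m)
  define S' where "S' = S - {Max S}"
  have S: "S \<noteq> {}" "finite S" using Suc.prems by auto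
  then have MS: "Max S \<in> S" by simp
  have S': "finite S'" "card S' = Suc m"
    using Suc.prems MS by (auto simp: S'_def)
  then have ne: "S' \<noteq> {}" by auto
  obtain R where R: "finite R" "card R = m" "R \<subseteq> {Min S'<..<Max S'}"
    "\<forall>x\<in>R. poly (pderiv p) x = 0"
    using Suc.IH[OF S'] Suc.prems(3) by (auto simp: S'_def)
  have MS': "Max S' \<in> S'" using S' ne by simp
  then have lt: "Max S' < Max S"
    using S by (auto simp: S'_def less_le)
  have "\<exists>z. Max S' < z \<and> z < Max S \<and> DERIV (poly p) z :> 0"
    using lt MS MS' Suc.prems(3)
    by (intro Rolle) (auto simp: S'_def intro: continuous_intros real_differentiable_def[THEN iffD2] poly_DERIV)
  then obtain z where z: "Max S' < z" "z < Max S" "DERIV (poly p) z :> 0" by blast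
  have z0: "poly (pderiv p) z = 0"
    using z(3) poly_DERIV DERIV_unique by blast
  have "Min S \<le> Min S'"
    using S ne by (intro Min_antimono) (auto simp: S'_def)
  moreover have "Min S' \<le> Max S'"
    using S' ne by simp
  ultimately have "Min S \<le> Min S'" "Min S' \<le> Max S'" .
  then show ?case
    using R z z0 lt by (intro exI[of _ "insert z R"]) (auto simp: card_insert_if)
qed

section \<open>Gauss quadrature on the unit interval\<close>

text \<open>As long as \<open>k < n\<close>, the endpoints 0 and 1 are roots as well, so
  \<open>k\<close> interior roots become \<open>k + 2\<close> roots and Rolle returns
  \<open>k + 1\<close> interior ones.\<close>

lemma roots_pderiv_iter_bump:
  "k \<le> n \<Longrightarrow> \<exists>R. finite R \<and> card R = k \<and> R \<subseteq> {0<..<1} \<and>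
     (\<forall>x\<in>R. poly ((pderiv ^^ k) ([:0, - 1, 1::real:] ^ n)) x = 0)"
proof (induction k)
  case 0
  then show ?case by (intro exI[of _ "{}"]) auto
next
  case (Suc k)
  let ?p = "(pderiv ^^ k) ([:0, - 1, 1::real:] ^ n)"
  obtain R where R: "finite R" "card R = k" "R \<subseteq> {0<..<1}" "\<forall>x\<in>R. poly ?p x = 0"
    using Suc by auto
  define S where "S = insert 0 (insert 1 R)"
  have S: "finite S" "card S = Suc (Suc k)"
    using R by (auto simp: S_def card_insert_if)
  obtain r where r: "?p = [:0, - 1, 1:] ^ (n - k) * r"
    using power_dvd_pderiv_iter[of k n "[:0, - 1, 1::real:]"] Suc.prems by (auto elim: dvdE)
  have "poly ?p x = 0" if "x \<in> S" for x
    using that R(4) Suc.prems unfolding S_def by (auto simp: r)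
  from pderiv_roots_between[OF S this]
  obtain R' where R': "finite R'" "card R' = Suc k" "R' \<subseteq> {Min S<..<Max S}"
    "\<forall>x\<in>R'. poly (pderiv ?p) x = 0"
    by blast
  have "Min S \<in> S" "Max S \<in> S" using S by (auto intro: Min_in Max_in)
  then have "{Min S<..<Max S} \<subseteq> {0<..<1}"
    using R(3) unfolding S_def by (smt (verit) greaterThanLessThan_iff insert_iff subset_eq)
  with R' show ?case
    by (intro exI[of _ R']) auto
qed

lemma degree_pderiv_iter: "degree ((pderiv ^^ k) (p :: real poly)) = degree p - k"
  by (induction k) (auto simp: degree_pderiv)

section \<open>Legendre polynomials: degree, roots, orthogonality\<close>

lemma legendre01:
  shows legendre01_nonzero: "legendre01 n \<noteq> 0"
    and degree_legendre01: "degree (legendre01 n) = n"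
proof -
  have deg: "degree ([:0, - 1, 1::real:] ^ n) = 2 * n"
    by (simp add: degree_power_eq)
  show "degree (legendre01 n) = n"
    by (simp add: legendre01_def degree_pderiv_iter deg)
  then show "legendre01 n \<noteq> 0"
    by (cases n) (auto simp: legendre01_def)
qed

text \<open>Rolle supplies \<open>n\<close> distinct roots in the open interval and the degree
  admits no others. All roots are therefore simple, and a set of nodes loses no
  multiplicity.\<close>

lemma gauss_nodes:
  shows finite_gauss_nodes: "finite (gauss_nodes n)"
    and card_gauss_nodes: "card (gauss_nodes n) = n"
    and gauss_nodes_subset: "gauss_nodes n \<subseteq> {0<..<1}"
proof -
  show fin: "finite (gauss_nodes n)"
    unfolding gauss_nodes_def by (rule poly_roots_finite[OF legendre01_nonzero])
  obtain R where R: "finite R" "card R = n" "R \<subseteq> {0<..<1}"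
    "\<forall>x\<in>R. poly ((pderiv ^^ n) ([:0, - 1, 1::real:] ^ n)) x = 0"
    using roots_pderiv_iter_bump[of n n] by auto
  have sub: "R \<subseteq> gauss_nodes n"
    using R(4) by (auto simp: gauss_nodes_def legendre01_def)
  have "card (gauss_nodes n) \<le> n"
    using card_poly_roots_bound[OF legendre01_nonzero[of n]]
    by (simp add: gauss_nodes_def degree_legendre01)
  then have "R = gauss_nodes n"
    using R(2) by (intro card_seteq[OF fin sub]) simp
  then show "card (gauss_nodes n) = n" "gauss_nodes n \<subseteq> {0<..<1}"
    using R by auto
qed

text \<open>Repeated integration by parts moves the \<open>k\<close> derivatives onto
  \<open>q\<close>; the boundary terms vanish because a factor \<open>x^2 - x\<close> survives. For
  \<open>k = n\<close> the hypothesis on \<open>q\<close> holds for every polynomial of degree below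
  \<open>n\<close>.\<close>

lemma pderiv_iter_bump_orthogonal:
  "k \<le> n \<Longrightarrow> (pderiv ^^ k) q = 0 \<Longrightarrow>
     integral {0..1} (poly ((pderiv ^^ k) ([:0, - 1, 1::real:] ^ n) * q)) = 0"
proof (induction k arbitrary: q)
  case (Suc k)
  let ?p = "(pderiv ^^ k) ([:0, - 1, 1::real:] ^ n)"
  obtain r where r: "?p = [:0, - 1, 1:] ^ (n - k) * r"
    using power_dvd_pderiv_iter[of k n "[:0, - 1, 1::real:]"] Suc.prems by (auto elim: dvdE)
  have "integral {0..1} (poly (pderiv ?p * q))
      = integral {0..1} (\<lambda>x. poly (pderiv (?p * q)) x - poly (?p * pderiv q) x)"
    by (intro integral_cong) (simp add: pderiv_mult algebra_simps)
  also have "\<dots> = integral {0..1} (poly (pderiv (?p * q))) - integral {0..1} (poly (?p * pderiv q))"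
    by (intro Henstock_Kurzweil_Integration.integral_diff poly_integrable_on)
  also have "integral {0..1} (poly (pderiv (?p * q))) = 0"
    using Suc.prems by (subst integral_pderiv) (auto simp: r)
  also have "integral {0..1} (poly (?p * pderiv q)) = 0"
    using Suc.prems by (intro Suc.IH) (auto simp: funpow_swap1)
  finally show ?case by simp
qed (simp add: poly_0[abs_def])

lemma legendre01_orthogonal:
  assumes "degree q < n"
  shows "integral {0..1} (poly (legendre01 n * q)) = 0"
proof -
  have "degree ((pderiv ^^ degree q) q) = 0"
    by (simp add: degree_pderiv_iter)
  then have "(pderiv ^^ Suc (degree q)) q = 0"
    by (simp add: pderiv_eq_0_iff)
  moreover have "(pderiv ^^ n) q = (pderiv ^^ (n - Suc (degree q))) ((pderiv ^^ Suc (degree q)) q)"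
    using assms by (simp add: funpow_add[symmetric, THEN fun_cong, unfolded o_apply] del: funpow.simps)
  moreover have "(pderiv ^^ j) (0::real poly) = 0" for j
    by (induction j) auto
  ultimately have "(pderiv ^^ n) q = 0"
    by metis
  from pderiv_iter_bump_orthogonal[OF order_refl this]
  have "integral {0..1} (\<lambda>x. 1 / fact n * poly ((pderiv ^^ n) ([:0, - 1, 1:] ^ n) * q) x) = 0"
    by (simp only: integral_mult_right mult_zero_right)
  then show ?thesis
    by (simp add: legendre01_def poly_smult[abs_def])
qed

section \<open>Gauss weights and degree of exactness\<close>

text \<open>The integrand of \<open>gauss_weight\<close> as a formal polynomial, so that degree
  arguments apply to it.\<close>

definition lagrange_poly :: "nat \<Rightarrow> real \<Rightarrow> real poly" where
  "lagrange_poly n x = (\<Prod>z\<in>gauss_nodes n - {x}. smult (1 / (x - z)) [:- z, 1:])"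

lemma poly_lagrange_poly:
  "poly (lagrange_poly n x) y = (\<Prod>z\<in>gauss_nodes n - {x}. (y - z) / (x - z))"
  by (simp add: lagrange_poly_def poly_prod algebra_simps diff_divide_distrib)

lemma poly_lagrange_poly_node:
  assumes "x \<in> gauss_nodes n" "y \<in> gauss_nodes n"
  shows "poly (lagrange_poly n x) y = (if x = y then 1 else 0)"
  using assms by (auto simp: poly_lagrange_poly prod_zero_iff finite_gauss_nodes intro!: prod.neutral)

lemma degree_lagrange_poly:
  assumes "x \<in> gauss_nodes n"
  shows "degree (lagrange_poly n x) < n"
proof -
  have "degree (lagrange_poly n x) \<le> (\<Sum>z\<in>gauss_nodes n - {x}. degree (smult (1 / (x - z)) [:- z, 1:]))"
    unfolding lagrange_poly_def
    by (rule order_trans[OF degree_prod_sum_le]) (simp_all add: finite_gauss_nodes o_def)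
  also have "\<dots> \<le> (\<Sum>z\<in>gauss_nodes n - {x}. 1)"
    by (intro sum_mono) simp
  also have "\<dots> = n - 1"
    using assms by (simp add: finite_gauss_nodes card_gauss_nodes)
  also have "\<dots> < n"
    using assms finite_gauss_nodes[of n] card_gauss_nodes[of n] by (cases n) auto
  finally show ?thesis .
qed

lemma gauss_weight_eq: "gauss_weight n x = integral {0..1} (poly (lagrange_poly n x))"
  by (simp add: gauss_weight_def poly_lagrange_poly[abs_def])

text \<open>A polynomial of degree below \<open>n\<close> equals its Lagrange interpolant at the
  \<open>n\<close> nodes, and the weights are the integrals of the Lagrange polynomials.\<close>

lemma gauss_exact_interpolatory:
  assumes "degree p < n"
  shows "integral {0..1} (poly p) = (\<Sum>x\<in>gauss_nodes n. gauss_weight n x * poly p x)"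
proof -
  define q where "q = (\<Sum>x\<in>gauss_nodes n. smult (poly p x) (lagrange_poly n x))"
  have "p = q"
  proof (rule poly_eqI_degree[of "gauss_nodes n"])
    show "poly p y = poly q y" if "y \<in> gauss_nodes n" for y
    proof -
      have "poly q y = (\<Sum>x\<in>gauss_nodes n. if x = y then poly p x else 0)"
        unfolding q_def poly_sum
        by (intro sum.cong) (auto simp: poly_lagrange_poly_node that)
      then show ?thesis
        by (simp add: finite_gauss_nodes that)
    qed
    have "degree q < n"
      unfolding q_def using assms
      by (intro degree_sum_less) (auto intro: le_less_trans[OF degree_smult_le] degree_lagrange_poly)
    then show "degree q < card (gauss_nodes n)" "degree p < card (gauss_nodes n)"
      using assms by (simp_all add: card_gauss_nodes)
  qed
  have "integral {0..1} (poly p) =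
      integral {0..1} (\<lambda>y. \<Sum>x\<in>gauss_nodes n. poly p x * poly (lagrange_poly n x) y)"
    by (subst \<open>p = q\<close>) (simp add: q_def poly_sum[abs_def])
  also have "\<dots> = (\<Sum>x\<in>gauss_nodes n. integral {0..1} (\<lambda>y. poly p x * poly (lagrange_poly n x) y))"
    by (intro integral_sum finite_gauss_nodes integrable_on_mult_right poly_integrable_on)
  also have "\<dots> = (\<Sum>x\<in>gauss_nodes n. gauss_weight n x * poly p x)"
    by (simp add: gauss_weight_eq mult.commute)
  finally show ?thesis .
qed

text \<open>Division with remainder by the Legendre polynomial: the quotient has degree below
  \<open>n\<close>, so its product with the divisor integrates to zero by orthogonality and vanishes
  at the nodes. Only the remainder counts, and interpolation handles it.\<close>

lemma gauss_exact:
  assumes "degree p < 2 * n"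
  shows "integral {0..1} (poly p) = (\<Sum>x\<in>gauss_nodes n. gauss_weight n x * poly p x)"
proof -
  let ?L = "legendre01 n"
  have n: "n > 0" using assms by simp
  have r: "degree (p mod ?L) < n"
    using degree_mod_less[OF legendre01_nonzero[of n], of p] n by (auto simp: degree_legendre01)
  have q: "degree (p div ?L) < n"
  proof (cases "p div ?L = 0")
    case False
    have "degree (?L * (p div ?L)) = degree (p - p mod ?L)"
      by (simp add: minus_mod_eq_mult_div)
    also have "\<dots> < 2 * n"
      using degree_diff_le_max[of p "p mod ?L"] assms r by linarith
    finally show ?thesis
      using False by (simp add: degree_mult_eq legendre01_nonzero degree_legendre01)
  qed (use n in simp)
  have "integral {0..1} (poly p) = integral {0..1} (\<lambda>x. poly (?L * (p div ?L)) x + poly (p mod ?L) x)"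
    by (simp only: poly_add[symmetric] mult_div_mod_eq)
  also have "\<dots> = integral {0..1} (poly (?L * (p div ?L))) + integral {0..1} (poly (p mod ?L))"
    by (intro Henstock_Kurzweil_Integration.integral_add poly_integrable_on)
  also have "\<dots> = (\<Sum>x\<in>gauss_nodes n. gauss_weight n x * poly (p mod ?L) x)"
    using legendre01_orthogonal[OF q] gauss_exact_interpolatory[OF r] by simp
  also have "\<dots> = (\<Sum>x\<in>gauss_nodes n. gauss_weight n x * poly p x)"
  proof (intro sum.cong refl)
    fix x assume "x \<in> gauss_nodes n"
    moreover have "poly p x = poly ?L x * poly (p div ?L) x + poly (p mod ?L) x"
      by (simp only: poly_add[symmetric] poly_mult[symmetric] mult_div_mod_eq)
    ultimately show "gauss_weight n x * poly (p mod ?L) x = gauss_weight n x * poly p x"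
      by (simp add: gauss_nodes_def)
  qed
  finally show ?thesis .
qed

text \<open>The square of a Lagrange polynomial is still integrated exactly and is 1 at one node and
  0 at the others, so the weight is the integral of a square.\<close>

lemma gauss_weight_nonneg:
  assumes "x \<in> gauss_nodes n"
  shows "0 \<le> gauss_weight n x"
proof -
  let ?l = "lagrange_poly n x"
  have "degree (?l * ?l) < 2 * n"
    using degree_mult_le[of ?l ?l] degree_lagrange_poly[OF assms] by linarith
  then have "integral {0..1} (poly (?l * ?l)) = (\<Sum>y\<in>gauss_nodes n. gauss_weight n y * poly (?l * ?l) y)"
    by (rule gauss_exact)
  also have "\<dots> = (\<Sum>y\<in>gauss_nodes n. if x = y then gauss_weight n y else 0)"
    by (intro sum.cong) (auto simp: poly_lagrange_poly_node assms)
  also have "\<dots> = gauss_weight n x"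
    using assms by (simp add: finite_gauss_nodes)
  finally show ?thesis
    by (metis (no_types, lifting) integral_nonneg poly_integrable_on poly_mult zero_le_square)
qed

section \<open>Tensor Gauss quadrature\<close>

text \<open>Tonelli for products. Nonnegativity permits a detour through the Lebesgue integral with
  values in \<open>ennreal\<close>; monomials on the cube, to which the lemma is applied, have
  it.\<close>

lemma integral_unit_cube_prod:
  fixes f :: "'k::finite \<Rightarrow> real \<Rightarrow> real"
  assumes cont: "\<And>i. continuous_on {0..1} (f i)"
    and nonneg: "\<And>i x. x \<in> {0..1} \<Longrightarrow> 0 \<le> f i x"
  shows "integral (cbox 0 1) (\<lambda>x::real^'k. \<Prod>i\<in>UNIV. f i (x $ i)) = (\<Prod>i\<in>UNIV. integral {0..1} (f i))"
proof -
  \<comment> \<open>Extension by zero turns the integral over the cube into one over the whole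
    space, where the product rule is available.\<close>
  define F where "F i x = indicator {0..1} x * f i x" for i x
  have F[measurable]: "F i \<in> borel_measurable borel" for i
    using borel_measurable_continuous_on_indicator[OF _ cont[of i]] by (simp add: F_def[abs_def])
  have F0: "0 \<le> F i x" for i x
    using nonneg by (auto simp: F_def indicator_def)
  have intF: "(\<integral>\<^sup>+x. ennreal (F i x) \<partial>lborel) = ennreal (integral {0..1} (f i))" for i
    unfolding F_def
    by (intro nn_integral_has_integral_lebesgue nonneg integrable_integral
        integrable_continuous_real cont)
  have bij: "bij_betw (\<lambda>i. axis i (1::real)) UNIV (Basis :: (real^'k) set)"
    by (auto simp: bij_betw_def inj_on_def axis_eq_axis Basis_vec_def)
  have reidx: "(\<Prod>b\<in>Basis. G (axis_index b) (x \<bullet> b)) = (\<Prod>i\<in>UNIV. G i (x $ i))"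
    for G :: "'k \<Rightarrow> real \<Rightarrow> 'c::comm_monoid_mult" and x :: "real^'k"
    by (subst prod.reindex_bij_betw[OF bij, symmetric]) (simp add: inner_axis)
  have "(\<integral>\<^sup>+x. ennreal (\<Prod>i\<in>UNIV. F i (x $ i)) \<partial>(lborel :: (real^'k) measure))
      = (\<integral>\<^sup>+x. (\<Prod>b\<in>Basis. ennreal (F (axis_index b) (x \<bullet> b))) \<partial>(lborel :: (real^'k) measure))"
    by (subst reidx[of "\<lambda>i x. ennreal (F i x)"]) (simp add: prod_ennreal F0)
  also have "\<dots> = (\<Prod>b\<in>(Basis :: (real^'k) set). \<integral>\<^sup>+x. ennreal (F (axis_index b) x) \<partial>lborel)"
    by (rule nn_integral_lborel_prod) auto
  also have "\<dots> = (\<Prod>i\<in>UNIV. ennreal (integral {0..1} (f i)))"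
    by (subst prod.reindex_bij_betw[OF bij, symmetric]) (simp add: intF)
  also have "\<dots> = ennreal (\<Prod>i\<in>UNIV. integral {0..1} (f i))"
    by (intro prod_ennreal integral_nonneg integrable_continuous_real cont nonneg)
  finally have eq: "(\<integral>\<^sup>+x. ennreal (\<Prod>i\<in>UNIV. F i (x $ i)) \<partial>(lborel :: (real^'k) measure))
      = ennreal (\<Prod>i\<in>UNIV. integral {0..1} (f i))" .
  have "((\<lambda>x::real^'k. \<Prod>i\<in>UNIV. F i (x $ i)) has_integral (\<Prod>i\<in>UNIV. integral {0..1} (f i))) UNIV"
  proof (rule nn_integral_has_integral[OF _ _ eq])
    show "(\<lambda>x::real^'k. \<Prod>i\<in>UNIV. F i (x $ i)) \<in> borel_measurable borel"
      by measurable
  qed (auto intro!: prod_nonneg F0 Henstock_Kurzweil_Integration.integral_nonneg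
        integrable_continuous_real cont nonneg)
  moreover have "(\<Prod>i\<in>UNIV. F i (x $ i)) = (if x \<in> cbox 0 1 then \<Prod>i\<in>UNIV. f i (x $ i) else 0)"
    for x :: "real^'k"
    by (auto simp: F_def mem_box_cart indicator_def intro!: prod.cong)
  ultimately have "((\<lambda>x::real^'k. \<Prod>i\<in>UNIV. f i (x $ i)) has_integral (\<Prod>i\<in>UNIV. integral {0..1} (f i))) (cbox 0 1)"
    by (simp add: has_integral_restrict_UNIV)
  then show ?thesis
    by (rule integral_unique)
qed

text \<open>The degree is bounded in each variable separately, as suits a tensor rule. Generating
  the functions from monomials by linear operations reduces exactness to an induction.\<close>

inductive coord_poly :: "nat \<Rightarrow> (real^'k \<Rightarrow> real) \<Rightarrow> bool" for d where
  monom: "(\<And>i. e i \<le> d) \<Longrightarrow> coord_poly d (\<lambda>x. \<Prod>i\<in>UNIV. x $ i ^ e i)"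
| scale: "coord_poly d p \<Longrightarrow> coord_poly d (\<lambda>x. c * p x)"
| add: "coord_poly d p \<Longrightarrow> coord_poly d q \<Longrightarrow> coord_poly d (\<lambda>x. p x + q x)"

lemma coord_poly_const: "coord_poly d (\<lambda>x. c)"
  using coord_poly.scale[OF coord_poly.monom[of "\<lambda>_. 0" d], of c] by simp

lemma coord_poly_coord: "1 \<le> d \<Longrightarrow> coord_poly d (\<lambda>x. x $ i)"
  using coord_poly.monom[of "\<lambda>j. if j = i then 1 else 0" d]
  by (simp add: if_distrib[of "power _"] cong: if_cong)

lemma coord_poly_mono: "coord_poly d p \<Longrightarrow> d \<le> d' \<Longrightarrow> coord_poly d' p"
  by (induction rule: coord_poly.induct) (auto intro: coord_poly.intros le_trans)

lemma coord_poly_mult: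
  assumes "coord_poly d p" "coord_poly d' q"
  shows "coord_poly (d + d') (\<lambda>x. p x * q x)"
  using assms(1)
proof (induction rule: coord_poly.induct)
  case (monom e)
  show ?case
    using assms(2)
  proof (induction rule: coord_poly.induct)
    case (monom e')
    then show ?case
      using coord_poly.monom[of "\<lambda>i. e i + e' i" "d + d'"] \<open>\<And>i. e i \<le> d\<close>
      by (simp add: power_add prod.distrib add_mono)
  next
    case (scale p c)
    from coord_poly.scale[OF scale.IH, of c] show ?case by (simp add: algebra_simps)
  qed (simp add: distrib_left coord_poly.add)
next
  case (scale p c)
  from coord_poly.scale[OF scale.IH, of c] show ?case by (simp add: algebra_simps)
qed (simp add: distrib_right coord_poly.add)

lemma coord_poly_diff: "coord_poly d p \<Longrightarrow> coord_poly d q \<Longrightarrow> coord_poly d (\<lambda>x. p x - q x)"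
  using coord_poly.add[OF _ coord_poly.scale[of d q "- 1"]] by simp

lemma coord_poly_uminus: "coord_poly d p \<Longrightarrow> coord_poly d (\<lambda>x. - p x)"
  using coord_poly.scale[of d p "- 1"] by simp

lemma coord_poly_sum:
  "(\<And>i. i \<in> A \<Longrightarrow> coord_poly d (p i)) \<Longrightarrow> coord_poly d (\<lambda>x. \<Sum>i\<in>A. p i x)"
  by (induction A rule: infinite_finite_induct) (auto intro: coord_poly_const coord_poly.add)

lemma coord_poly_power: "coord_poly d p \<Longrightarrow> coord_poly (n * d) (\<lambda>x. p x ^ n)"
  by (induction n) (auto intro: coord_poly_const coord_poly_mult)

lemma coord_poly_continuous: "coord_poly d p \<Longrightarrow> continuous_on A p"
  by (induction rule: coord_poly.induct) (intro continuous_intros; assumption?)+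

section \<open>The tensor rule: exactness and error bound\<close>

text \<open>Identifies node vectors with functions on the index type, so that the product of
  one-dimensional sums expands into the tensor sum.\<close>

lemma tensor_nodes_PiE:
  "bij_betw vec_lambda (PiE (UNIV :: 'k::finite set) (\<lambda>_. A)) {x :: 'a^'k. \<forall>i. x $ i \<in> A}"
proof (rule bij_betwI[where g = vec_nth])
qed (auto simp: vec_lambda_beta)

lemma gauss_quadrature_prod:
  fixes f :: "'k::finite \<Rightarrow> real \<Rightarrow> real"
  shows "gauss_quadrature n (\<lambda>x::real^'k. \<Prod>i\<in>UNIV. f i (x $ i))
    = (\<Prod>i\<in>UNIV. \<Sum>x\<in>gauss_nodes n. gauss_weight n x * f i x)"
  unfolding gauss_quadrature_def
  by (subst prod_sum_PiE)
     (auto simp: finite_gauss_nodes prod.distrib sum.reindex_bij_betw[OF tensor_nodes_PiE, symmetric])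

lemma gauss_quadrature_scale:
  fixes g :: "real^'k \<Rightarrow> real"
  shows "gauss_quadrature n (\<lambda>x. c * g x) = c * gauss_quadrature n g"
  by (simp add: gauss_quadrature_def sum_distrib_left mult_ac)

lemma gauss_quadrature_add:
  fixes f g :: "real^'k \<Rightarrow> real"
  shows "gauss_quadrature n (\<lambda>x. f x + g x) = gauss_quadrature n f + gauss_quadrature n g"
  by (simp add: gauss_quadrature_def sum.distrib distrib_left)

text \<open>On a monomial both sides factor into one-dimensional quantities; linearity does the
  rest. The case \<open>n = 0\<close> is excluded because \<open>2 * n - 1\<close> truncates to 0,
  whereas the rule without nodes does not reproduce constants.\<close>

lemma gauss_quadrature_exact:
  assumes "coord_poly (2 * n - 1) p" "1 \<le> n"
  shows "gauss_quadrature n p = integral (cbox 0 1) p"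
  using assms(1)
proof (induction rule: coord_poly.induct)
  case (monom e)
  have "integral {0..1} (\<lambda>x. x ^ e i) = (\<Sum>x\<in>gauss_nodes n. gauss_weight n x * x ^ e i)" for i
  proof -
    have "degree (Polynomial.monom (1::real) (e i)) < 2 * n"
      using monom[of i] assms(2) by (simp add: degree_monom_eq)
    from gauss_exact[OF this] show ?thesis
      by (simp add: poly_monom[abs_def])
  qed
  then show ?case
    unfolding gauss_quadrature_prod[of n "\<lambda>i x. x ^ e i"]
    by (subst integral_unit_cube_prod) (auto intro!: continuous_intros)
next
  case (scale p c)
  then show ?case
    by (simp add: gauss_quadrature_scale)
next
  case (add p q)
  then show ?case
    by (simp add: gauss_quadrature_add Henstock_Kurzweil_Integration.integral_add
        integrable_continuous coord_poly_continuous)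
qed

lemma integral_unit_cube_const: "integral (cbox 0 (1::real^'k)) (\<lambda>x. c) = (c::real)"
  using integral_unit_cube_prod[of "\<lambda>(_::'k) _. 1"]
    integral_mult_right[of "cbox 0 (1::real^'k)" c "\<lambda>_. 1"] by simp

lemma gauss_quadrature_const:
  "1 \<le> n \<Longrightarrow> gauss_quadrature n (\<lambda>x::real^'k. c) = (c::real)"
  by (simp only: gauss_quadrature_exact coord_poly_const integral_unit_cube_const)

lemma tensor_nodes_in_cube: "\<forall>i. x $ i \<in> gauss_nodes n \<Longrightarrow> x \<in> cbox 0 (1::real^'k)"
  using gauss_nodes_subset[of n] by (auto simp: mem_box_cart less_imp_le subset_eq)

lemma quadrature_error_le:
  fixes g :: "real^'k \<Rightarrow> real"
  assumes n: "1 \<le> n" and g: "continuous_on (cbox 0 1) g"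
    and p: "coord_poly (2 * n - 1) p" and eps: "\<And>x. x \<in> cbox 0 1 \<Longrightarrow> \<bar>g x - p x\<bar> \<le> \<epsilon>"
  shows "quadrature_error n g \<le> 2 * \<epsilon>"
proof -
  let ?X = "{x :: real^'k. \<forall>i. x $ i \<in> gauss_nodes n}"
  let ?w = "\<lambda>x :: real^'k. \<Prod>i\<in>UNIV. gauss_weight n (x $ i)"
  have int: "g integrable_on cbox 0 1" "p integrable_on cbox 0 1"
    using g p by (auto intro: integrable_continuous coord_poly_continuous)
  have "\<bar>integral (cbox 0 1) g - integral (cbox 0 1) p\<bar> = norm (integral (cbox 0 1) (\<lambda>x. g x - p x))"
    using int by (simp add: Henstock_Kurzweil_Integration.integral_diff)
  also have "\<dots> \<le> integral (cbox 0 (1::real^'k)) (\<lambda>x. \<epsilon>)"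
    using int eps by (intro integral_norm_bound_integral integrable_diff) auto
  finally have I: "\<bar>integral (cbox 0 1) g - integral (cbox 0 1) p\<bar> \<le> \<epsilon>"
    by (simp only: integral_unit_cube_const)
  have w: "0 \<le> ?w x" if "x \<in> ?X" for x
    using that by (intro prod_nonneg) (auto intro: gauss_weight_nonneg)
  have "\<bar>gauss_quadrature n g - gauss_quadrature n p\<bar> = \<bar>\<Sum>x\<in>?X. ?w x * (g x - p x)\<bar>"
    by (simp add: gauss_quadrature_def sum_subtractf right_diff_distrib)
  also have "\<dots> \<le> (\<Sum>x\<in>?X. ?w x * \<epsilon>)"
    by (intro order_trans[OF sum_abs] sum_mono)
       (auto simp: abs_mult intro!: mult_mono eps tensor_nodes_in_cube w[simplified] abs_ge_zero)
  also have "\<dots> = gauss_quadrature n (\<lambda>x::real^'k. \<epsilon>)"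
    by (simp add: gauss_quadrature_def)
  also have "\<dots> = \<epsilon>"
    by (rule gauss_quadrature_const[OF n])
  finally show ?thesis
    using I gauss_quadrature_exact[OF p n] by (simp add: quadrature_error_def)
qed

section \<open>Polynomial approximation on the unit cube\<close>

text \<open>Closed under sums and nonnegative multiples, so that the terms of a regularized
  integrand can be treated one by one. Continuity is carried along to guarantee
  integrability.\<close>

definition cube_approximable :: "nat \<Rightarrow> real \<Rightarrow> (real^'k \<Rightarrow> real) \<Rightarrow> bool" where
  "cube_approximable n \<epsilon> g \<longleftrightarrow> continuous_on (cbox 0 1) g \<and>
     (\<exists>p. coord_poly (2 * n - 1) p \<and> (\<forall>x\<in>cbox 0 1. \<bar>g x - p x\<bar> \<le> \<epsilon>))"

lemma quadrature_error_cube_approximable: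
  "cube_approximable n \<epsilon> g \<Longrightarrow> 1 \<le> n \<Longrightarrow> quadrature_error n g \<le> 2 * \<epsilon>"
  unfolding cube_approximable_def by (blast intro: quadrature_error_le)

lemma cube_approximable_add:
  assumes "cube_approximable n \<epsilon> f" "cube_approximable n \<delta> g"
  shows "cube_approximable n (\<epsilon> + \<delta>) (\<lambda>x. f x + g x)"
proof -
  obtain p q where pq: "coord_poly (2 * n - 1) p" "\<And>x. x \<in> cbox 0 1 \<Longrightarrow> \<bar>f x - p x\<bar> \<le> \<epsilon>"
    "coord_poly (2 * n - 1) q" "\<And>x. x \<in> cbox 0 1 \<Longrightarrow> \<bar>g x - q x\<bar> \<le> \<delta>"
    using assms unfolding cube_approximable_def by blast
  have "\<bar>f x + g x - (p x + q x)\<bar> \<le> \<epsilon> + \<delta>" if "x \<in> cbox 0 1" for x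
    using pq(2,4)[OF that] by linarith
  then show ?thesis
    using assms pq(1,3) unfolding cube_approximable_def
    by (intro conjI exI[of _ "\<lambda>x. p x + q x"]) (auto intro: continuous_intros coord_poly.add)
qed

lemma cube_approximable_scale:
  assumes "cube_approximable n \<epsilon> f" "0 \<le> c"
  shows "cube_approximable n (c * \<epsilon>) (\<lambda>x. c * f x)"
proof -
  obtain p where p: "coord_poly (2 * n - 1) p" "\<And>x. x \<in> cbox 0 1 \<Longrightarrow> \<bar>f x - p x\<bar> \<le> \<epsilon>"
    using assms unfolding cube_approximable_def by blast
  have "\<bar>c * f x - c * p x\<bar> \<le> c * \<epsilon>" if "x \<in> cbox 0 1" for x
    using p(2)[OF that] assms(2)
    by (simp add: abs_mult right_diff_distrib[symmetric] mult_left_mono)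
  then show ?thesis
    using assms p(1) unfolding cube_approximable_def
    by (intro conjI exI[of _ "\<lambda>x. c * p x"]) (auto intro: continuous_intros coord_poly.scale)
qed

lemma cube_approximable_cong:
  assumes "cube_approximable n \<epsilon> f" "\<And>x. x \<in> cbox 0 1 \<Longrightarrow> f x = g x"
  shows "cube_approximable n \<epsilon> g"
  using assms continuous_on_cong[of "cbox 0 1" "cbox 0 1" f g]
  unfolding cube_approximable_def by metis

text \<open>The binomial series converges at a radius \<open>t\<close> beyond
  \<open>1 - \<delta>\<close>, so its terms there are bounded. On the smaller disc they decay
  geometrically with ratio \<open>(1 - \<delta>) / t\<close>, and so does the tail.\<close>

lemma powr_binomial_truncation:
  fixes a \<delta> :: real
  assumes "0 < \<delta>" "\<delta> < 1"
  shows "\<exists>K q. 0 < K \<and> 0 < q \<and> q < 1 \<and>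
    (\<forall>N u. \<delta> \<le> u \<and> u \<le> 1 \<longrightarrow> \<bar>u powr a - (\<Sum>k<N. (a gchoose k) * (u - 1) ^ k)\<bar> \<le> K * q ^ N)"
proof -
  \<comment> \<open>The midpoint of \<open>1 - \<delta>\<close> and 1; any number strictly between
    them would do.\<close>
  define t where "t = 1 - \<delta> / 2"
  define q where "q = (1 - \<delta>) / t"
  have t: "0 < t" "t < 1" "1 - \<delta> < t" using assms by (auto simp: t_def)
  have q: "0 < q" "q < 1" using assms t by (auto simp: q_def)
  have "summable (\<lambda>k. (a gchoose k) * t ^ k)"
    using gen_binomial_real[of t a] t by (auto simp: sums_iff)
  then have "Bseq (\<lambda>k. (a gchoose k) * t ^ k)"
    using summable_LIMSEQ_zero convergent_imp_Bseq convergentI by blast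
  then obtain B where B: "0 < B" "\<And>k. \<bar>(a gchoose k) * t ^ k\<bar> \<le> B"
    by (auto simp: Bseq_def)
  have coeff: "\<bar>(a gchoose k) * (u - 1) ^ k\<bar> \<le> B * q ^ k" if u: "\<delta> \<le> u" "u \<le> 1" for k u
  proof -
    have "\<bar>(a gchoose k) * (u - 1) ^ k\<bar> \<le> \<bar>a gchoose k\<bar> * (1 - \<delta>) ^ k"
      using u by (auto simp: abs_mult power_abs intro!: mult_left_mono power_mono)
    also have "\<dots> = \<bar>(a gchoose k) * t ^ k\<bar> * q ^ k"
      using t by (simp add: q_def abs_mult power_abs power_divide)
    also have "\<dots> \<le> B * q ^ k"
      using B q by (intro mult_right_mono) auto
    finally show ?thesis .
  qed
  have "\<bar>u powr a - (\<Sum>k<N. (a gchoose k) * (u - 1) ^ k)\<bar> \<le> B / (1 - q) * q ^ N"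
    if u: "\<delta> \<le> u" "u \<le> 1" for N u
  proof -
    let ?f = "\<lambda>k. (a gchoose k) * (u - 1) ^ k"
    have f: "?f sums (u powr a)"
      using gen_binomial_real[of "u - 1" a] u assms by simp
    have geo: "(\<lambda>k. B * q ^ N * q ^ k) sums (B * q ^ N * (1 / (1 - q)))"
      using q by (intro sums_mult geometric_sums) simp
    have "u powr a - (\<Sum>k<N. ?f k) = (\<Sum>k. ?f (k + N))"
      using f suminf_minus_initial_segment[of ?f N] by (simp add: sums_iff)
    also have "norm \<dots> \<le> (\<Sum>k. B * q ^ N * q ^ k)"
    proof (rule norm_suminf_le)
      show "norm (?f (k + N)) \<le> B * q ^ N * q ^ k" for k
        using coeff[OF u, of "k + N"] by (simp add: power_add mult_ac)
    qed (use geo in \<open>auto simp: sums_iff\<close>)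
    also have "\<dots> = B / (1 - q) * q ^ N"
      using geo by (simp add: sums_iff)
    finally show ?thesis by simp
  qed
  moreover have "0 < B / (1 - q)"
    using B q by simp
  ultimately show ?thesis
    using q by blast
qed

text \<open>Composing a truncated power series with a polynomial multiplies the number of terms by the
  degree; this only changes the base of the exponential rate.\<close>

lemma cube_approximable_powr:
  fixes a \<delta> :: real
  assumes "0 < \<delta>" "\<delta> < 1" "1 \<le> d"
  shows "\<exists>C q. 0 < C \<and> 0 < q \<and> q < 1 \<and>
    (\<forall>n A (r :: real^'k \<Rightarrow> real). coord_poly d A \<and> coord_poly d r \<and>
       (\<forall>x\<in>cbox 0 1. \<bar>A x\<bar> \<le> 1 \<and> \<delta> \<le> r x \<and> r x \<le> 1) \<longrightarrow>
       cube_approximable n (C * q ^ n) (\<lambda>x. A x * r x powr a))"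
proof -
  obtain K q where K: "0 < K" and q: "0 < q" "q < 1"
    and trunc: "\<And>N u. \<delta> \<le> u \<Longrightarrow> u \<le> 1 \<Longrightarrow>
      \<bar>u powr a - (\<Sum>k<N. (a gchoose k) * (u - 1) ^ k)\<bar> \<le> K * q ^ N"
    using powr_binomial_truncation[OF assms(1,2), of a] by metis
  \<comment> \<open>About \<open>2 n / d\<close> terms of the series fit into the degree
    \<open>2 n - 1\<close>.\<close>
  define q' where "q' = q powr (2 / d)"
  have q': "0 < q'" "q' < 1"
    using q assms(3) powr_less_mono2[of "2 / d" q 1] by (auto simp: q'_def)
  have "cube_approximable n (K / q\<^sup>2 * q' ^ n) (\<lambda>x. A x * r x powr a)"
    if "coord_poly d A" "coord_poly d r"
      and bnd: "\<And>x. x \<in> cbox 0 1 \<Longrightarrow> \<bar>A x\<bar> \<le> 1 \<and> \<delta> \<le> r x \<and> r x \<le> 1"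
    for n and A r :: "real^'k \<Rightarrow> real"
  proof -
    \<comment> \<open>One multiple of \<open>d\<close> is set aside for the factor \<open>A\<close>,
      the others serve the powers of \<open>r\<close>.\<close>
    define N where "N = (2 * n - 1) div d - 1"
    define p where "p x = A x * (\<Sum>k<N. (a gchoose k) * (r x - 1) ^ k)" for x
    have p: "coord_poly (2 * n - 1) p"
    \<comment> \<open>Here \<open>A\<close> alone may exceed the admissible degree, but the empty
      sum makes \<open>p\<close> zero.\<close>
    proof (cases "N = 0")
      case True
      then show ?thesis
        by (simp add: p_def[abs_def] coord_poly_const)
    next
      case False
      have "coord_poly (d + N * d) p"
        unfolding p_def using that(1,2)
        by (intro coord_poly_mult coord_poly_sum coord_poly.scale
            coord_poly_mono[OF coord_poly_power[OF coord_poly_diff]] coord_poly_const) auto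
      moreover have "d + N * d \<le> 2 * n - 1"
      proof -
        have "d + N * d = ((2 * n - 1) div d) * d"
          using False by (simp add: N_def mult_eq_if)
        then show ?thesis by simp
      qed
      ultimately show ?thesis
        by (rule coord_poly_mono)
    qed
    \<comment> \<open>Rounding and the reserved factor together cost at most two terms, hence the
      factor \<open>1 / q^2\<close> in the constant.\<close>
    have N: "2 * real n / d - 2 \<le> N"
    proof -
      have "2 * n \<le> d * ((2 * n - 1) div d) + d"
        using assms(3) mult_div_mod_eq[of d "2 * n - 1"] mod_less_divisor[of d "2 * n - 1"]
        by linarith
      also have "\<dots> \<le> d * (N + 2)"
        by (cases "(2 * n - 1) div d") (auto simp: N_def)
      finally have "real (2 * n) \<le> real (d * (N + 2))"
        by (simp only: of_nat_le_iff)
      then show ?thesis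
        using assms(3) by (simp add: field_simps)
    qed
    have "q ^ N = q powr N"
      using q by (simp add: powr_realpow)
    also have "\<dots> \<le> q powr (2 * real n / d - 2)"
      using N q by (intro powr_mono') auto
    also have "\<dots> = q' ^ n / q\<^sup>2"
    proof -
      have "q' ^ n = q powr (2 * real n / d)"
        using powr_realpow[OF q'(1), of n] by (simp add: q'_def powr_powr)
      moreover have "q powr 2 = q\<^sup>2"
        using q by simp
      ultimately show ?thesis
        by (simp add: powr_diff)
    qed
    finally have "K * q ^ N \<le> K * (q' ^ n / q\<^sup>2)"
      using K by (intro mult_left_mono) auto
    then have qN: "K * q ^ N \<le> K / q\<^sup>2 * q' ^ n"
      by simp
    have "\<bar>A x * r x powr a - p x\<bar> \<le> K / q\<^sup>2 * q' ^ n" if x: "x \<in> cbox 0 1" for x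
    proof -
      have "\<bar>A x * r x powr a - p x\<bar>
          = \<bar>A x\<bar> * \<bar>r x powr a - (\<Sum>k<N. (a gchoose k) * (r x - 1) ^ k)\<bar>"
        by (simp add: p_def abs_mult[symmetric] right_diff_distrib)
      also have "\<dots> \<le> 1 * (K * q ^ N)"
        using bnd[OF x] by (intro mult_mono trunc) auto
      finally show ?thesis
        using qN by simp
    qed
    moreover have "continuous_on (cbox 0 1) (\<lambda>x. A x * r x powr a)"
    proof (intro continuous_intros coord_poly_continuous[OF that(1)] coord_poly_continuous[OF that(2)])
      show "\<forall>x\<in>cbox 0 1. r x \<noteq> 0"
        using bnd assms(1) by fastforce
    qed
    ultimately show ?thesis
      using p unfolding cube_approximable_def by blast
  qed
  moreover have "0 < K / q\<^sup>2"
    using K q by simp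
  ultimately show ?thesis
    using q' by (intro exI[of _ "K / q\<^sup>2"] exI[of _ q']) auto
qed

section \<open>The transformed kernel\<close>

lemma tet_map_eq:
  "tet_map P x = P$1 + x$1 *\<^sub>R (P$2 - P$1) + x$2 *\<^sub>R (P$3 - P$2) + x$3 *\<^sub>R (P$4 - P$2)"
  unfolding tet_map_def tet_matrix_def vec_eq_iff
  by (simp add: matrix_vector_mult_def transpose_def sum_3 mult.commute)

lemma tri_map_eq:
  "tri_map Q y = Q$1 + y$1 *\<^sub>R (Q$2 - Q$1) + y$2 *\<^sub>R (Q$3 - Q$2)"
  unfolding tri_map_def tri_matrix_def vec_eq_iff
  by (simp add: matrix_vector_mult_def transpose_def sum_2 mult.commute)

lemma det_tet_matrix: "det (tet_matrix P) = (P$2 - P$1) \<bullet> cross3 (P$3 - P$2) (P$4 - P$2)"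
  unfolding tet_matrix_def det_transpose dot_cross_det ..

lemma norm_cross3_le: "norm (cross3 x y) \<le> norm x * norm y"
proof (rule power2_le_imp_le)
  show "(norm (cross3 x y))\<^sup>2 \<le> (norm x * norm y)\<^sup>2"
    by (simp add: norm_cross_dot[symmetric])
qed simp

lemma abs_triple_le: "\<bar>x \<bullet> cross3 y z\<bar> \<le> norm x * (norm y * norm z)"
  by (rule order_trans[OF Cauchy_Schwarz_ineq2]) (intro mult_left_mono norm_cross3_le norm_ge_zero)

text \<open>For the coordinate functions and Jacobians. The number 4 is the total degree of the
  Jacobian in the distant case, the largest one that occurs.\<close>

definition unit_poly :: "(real^'k \<Rightarrow> real) \<Rightarrow> bool" where
  "unit_poly p \<longleftrightarrow> coord_poly 4 p \<and> (\<forall>\<eta>\<in>cbox 0 1. \<bar>p \<eta>\<bar> \<le> 1)"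

text \<open>The six vectors from which the difference of the two transformed points is
  combined.\<close>

definition scaled_pair :: "real \<Rightarrow> real \<Rightarrow> real^3^4 \<Rightarrow> real^3^3 \<Rightarrow> bool" where
  "scaled_pair \<kappa> h P Q \<longleftrightarrow>
     norm (P$2 - P$1) \<le> \<kappa> * h \<and> norm (P$3 - P$2) \<le> \<kappa> * h \<and> norm (P$4 - P$2) \<le> \<kappa> * h \<and>
     norm (Q$2 - Q$1) \<le> \<kappa> * h \<and> norm (Q$3 - Q$2) \<le> \<kappa> * h \<and> norm (Q$1 - P$1) \<le> \<kappa> * h"

text \<open>Restricting to \<open>X\<close> covers both uses: a nodal function is affine only inside
  the element, its affine extension everywhere.\<close>

definition bounded_affine_at :: "(real^3 \<Rightarrow> real) \<Rightarrow> real^3^4 \<Rightarrow> (real^3) set \<Rightarrow> bool" where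
  "bounded_affine_at f P X \<longleftrightarrow>
     (\<exists>c l. \<bar>c\<bar> \<le> 1 \<and> (\<forall>i. \<bar>l$i\<bar> \<le> 2) \<and> (\<forall>x\<in>X. f (tet_map P x) = c + l \<bullet> x))"

lemma coord_poly_scale_right: "coord_poly d p \<Longrightarrow> coord_poly d (\<lambda>x. p x * c)"
  using coord_poly.scale[of d p c] by (simp add: mult.commute)

text \<open>Common to all terms of all four cases, which differ only in the coordinate functions,
  the Jacobian and the lower bound \<open>m\<close>. The constants come before mesh, pair and
  coordinates: dividing the squared distance by \<open>(R * h)^2\<close> and the polynomial factors
  by \<open>B * h^6\<close> leaves polynomials of fixed degree with bounds free of
  \<open>h\<close>.\<close>

lemma cube_approximable_kernel:
  fixes \<kappa> m s :: real
  assumes "0 < \<kappa>" "0 < m"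
  obtains C q where "0 < C" "0 < q" "q < 1"
    and "\<And>n h P Q \<nu> f g x1 x2 x3 y1 y2 (J :: real^'k \<Rightarrow> real).
       0 < h \<Longrightarrow> scaled_pair \<kappa> h P Q \<Longrightarrow> norm \<nu> = 1 \<Longrightarrow>
       unit_poly x1 \<Longrightarrow> unit_poly x2 \<Longrightarrow> unit_poly x3 \<Longrightarrow> unit_poly y1 \<Longrightarrow> unit_poly y2 \<Longrightarrow> unit_poly J \<Longrightarrow>
       bounded_affine_at f P ((\<lambda>\<eta>. vector [x1 \<eta>, x2 \<eta>, x3 \<eta>]) ` cbox 0 1) \<Longrightarrow>
       bounded_affine_at g P ((\<lambda>\<eta>. vector [x1 \<eta>, x2 \<eta>, x3 \<eta>]) ` cbox 0 1) \<Longrightarrow>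
       (\<And>\<eta>. \<eta> \<in> cbox 0 1 \<Longrightarrow> m * h \<le> norm (tri_map Q (vector [y1 \<eta>, y2 \<eta>])
          - tet_map P (vector [x1 \<eta>, x2 \<eta>, x3 \<eta>]))) \<Longrightarrow>
       cube_approximable n (C * h powr (3 - 2 * s) * q ^ n)
         (\<lambda>\<eta>. kernel2 s f g P Q \<nu> (vector [x1 \<eta>, x2 \<eta>, x3 \<eta>]) (vector [y1 \<eta>, y2 \<eta>]) * J \<eta>)"
proof -
  \<comment> \<open>The distance is at most \<open>6 * \<kappa> * h\<close>, and 7 leaves some room.
    In \<open>B\<close>, 294 is 7 * 7 * 6: two shape functions bounded by 7 and the numerator
    bounded by \<open>6 * \<kappa> * h\<close>; the other five powers of \<open>\<kappa>\<close>
    come from determinant and cross product. The minimum keeps \<open>\<delta>\<close> below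
    1.\<close>
  define R where "R = 7 * \<kappa>"
  define \<delta> where "\<delta> = min (1 / 2) ((m / R)\<^sup>2)"
  define a where "a = - (3 + 2 * s) / 2"
  define B where "B = 294 * \<kappa> ^ 6"
  have R: "0 < R" and B: "0 < B"
    using assms by (auto simp: R_def B_def)
  have \<delta>: "0 < \<delta>" "\<delta> < 1" using assms R by (auto simp: \<delta>_def)
  have "(1::nat) \<le> 20" by simp
  from cube_approximable_powr[OF \<delta> this, of a] obtain C q
    where C: "0 < C" and q: "0 < q" "q < 1"
    and approx': "\<forall>n A (r :: real^'k \<Rightarrow> real). coord_poly 20 A \<and> coord_poly 20 r \<and>
       (\<forall>x\<in>cbox 0 1. \<bar>A x\<bar> \<le> 1 \<and> \<delta> \<le> r x \<and> r x \<le> 1) \<longrightarrow>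
       cube_approximable n (C * q ^ n) (\<lambda>x. A x * r x powr a)"
    by (elim exE conjE) (rule that)
  have approx: "cube_approximable n (C * q ^ n) (\<lambda>x. A x * r x powr a)"
    if "coord_poly 20 A" "coord_poly 20 r"
       "\<And>x. x \<in> cbox 0 1 \<Longrightarrow> \<bar>A x\<bar> \<le> 1 \<and> \<delta> \<le> r x \<and> r x \<le> 1"
    for n A and r :: "real^'k \<Rightarrow> real"
    using that by (intro approx'[rule_format] conjI ballI) auto
  define C' where "C' = C * (B * R powr (- (3 + 2 * s)))"
  have main: "cube_approximable n (C' * h powr (3 - 2 * s) * q ^ n)
         (\<lambda>\<eta>. kernel2 s f g P Q \<nu> (vector [x1 \<eta>, x2 \<eta>, x3 \<eta>]) (vector [y1 \<eta>, y2 \<eta>]) * J \<eta>)"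
    if h: "0 < h" and PQ: "scaled_pair \<kappa> h P Q" and \<nu>: "norm \<nu> = 1"
      and up: "unit_poly x1" "unit_poly x2" "unit_poly x3" "unit_poly y1" "unit_poly y2" "unit_poly J"
      and f: "bounded_affine_at f P ((\<lambda>\<eta>. vector [x1 \<eta>, x2 \<eta>, x3 \<eta>]) ` cbox 0 1)"
      and g: "bounded_affine_at g P ((\<lambda>\<eta>. vector [x1 \<eta>, x2 \<eta>, x3 \<eta>]) ` cbox 0 1)"
      and lower: "\<And>\<eta>. \<eta> \<in> cbox 0 1 \<Longrightarrow> m * h \<le> norm (tri_map Q (vector [y1 \<eta>, y2 \<eta>])
          - tet_map P (vector [x1 \<eta>, x2 \<eta>, x3 \<eta>]))"
    for n h P Q \<nu> f g x1 x2 x3 y1 y2 and J :: "real^'k \<Rightarrow> real"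
  proof -
    define X where "X \<eta> = (vector [x1 \<eta>, x2 \<eta>, x3 \<eta>] :: real^3)" for \<eta>
    define W where "W \<eta> = tri_map Q (vector [y1 \<eta>, y2 \<eta>]) - tet_map P (X \<eta>)" for \<eta>
    define D where "D = \<bar>det (tet_matrix P)\<bar> * norm (cross3 (Q$2 - Q$1) (Q$3 - Q$2))"
    have poly: "coord_poly 4 x1" "coord_poly 4 x2" "coord_poly 4 x3" "coord_poly 4 y1"
        "coord_poly 4 y2" "coord_poly 4 J"
      using up by (auto simp: unit_poly_def)
    have unit: "\<bar>x1 \<eta>\<bar> \<le> 1" "\<bar>x2 \<eta>\<bar> \<le> 1" "\<bar>x3 \<eta>\<bar> \<le> 1" "\<bar>y1 \<eta>\<bar> \<le> 1" "\<bar>y2 \<eta>\<bar> \<le> 1" "\<bar>J \<eta>\<bar> \<le> 1"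
      if "\<eta> \<in> cbox 0 1" for \<eta>
      using up that by (auto simp: unit_poly_def)
    have edges: "norm (P$2 - P$1) \<le> \<kappa> * h" "norm (P$3 - P$2) \<le> \<kappa> * h" "norm (P$4 - P$2) \<le> \<kappa> * h"
        "norm (Q$2 - Q$1) \<le> \<kappa> * h" "norm (Q$3 - Q$2) \<le> \<kappa> * h" "norm (Q$1 - P$1) \<le> \<kappa> * h"
      using PQ by (auto simp: scaled_pair_def)
    \<comment> \<open>The bound 7 is 1 for the constant term plus 2 for each of the three
      coordinates.\<close>
    have affine: "\<exists>p. coord_poly 4 p \<and> (\<forall>\<eta>\<in>cbox 0 1. F (tet_map P (X \<eta>)) = p \<eta> \<and> \<bar>p \<eta>\<bar> \<le> 7)"
      if bnd: "bounded_affine_at F P ((\<lambda>\<eta>. vector [x1 \<eta>, x2 \<eta>, x3 \<eta>]) ` cbox 0 1)" for F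
    proof -
      obtain c l where c: "\<bar>c\<bar> \<le> 1" and l: "\<And>i. \<bar>l$i\<bar> \<le> 2"
        and F: "\<And>\<eta>. \<eta> \<in> cbox 0 1 \<Longrightarrow> F (tet_map P (X \<eta>)) = c + l \<bullet> X \<eta>"
        using bnd unfolding bounded_affine_at_def X_def ball_simps by blast
      have eq: "c + l \<bullet> X \<eta> = c + (l$1 * x1 \<eta> + l$2 * x2 \<eta> + l$3 * x3 \<eta>)" for \<eta>
        by (simp add: X_def inner_vec_def sum_3)
      have "\<bar>l$1 * x1 \<eta>\<bar> \<le> 2 * 1" "\<bar>l$2 * x2 \<eta>\<bar> \<le> 2 * 1" "\<bar>l$3 * x3 \<eta>\<bar> \<le> 2 * 1"
        if "\<eta> \<in> cbox 0 1" for \<eta>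
        unfolding abs_mult by (intro mult_mono l unit[OF that] abs_ge_zero zero_le_numeral)+
      then have "\<bar>c + l \<bullet> X \<eta>\<bar> \<le> 7" if "\<eta> \<in> cbox 0 1" for \<eta>
        using c that unfolding eq by fastforce
      moreover have "coord_poly 4 (\<lambda>\<eta>. c + l \<bullet> X \<eta>)"
        unfolding eq by (intro coord_poly.add coord_poly_const coord_poly.scale poly)
      ultimately show ?thesis
        using F by blast
    qed
    obtain pf where pf: "coord_poly 4 pf"
      "\<And>\<eta>. \<eta> \<in> cbox 0 1 \<Longrightarrow> f (tet_map P (X \<eta>)) = pf \<eta>" "\<And>\<eta>. \<eta> \<in> cbox 0 1 \<Longrightarrow> \<bar>pf \<eta>\<bar> \<le> 7"
      using affine[OF f] by blast
    obtain pg where pg: "coord_poly 4 pg"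
      "\<And>\<eta>. \<eta> \<in> cbox 0 1 \<Longrightarrow> g (tet_map P (X \<eta>)) = pg \<eta>" "\<And>\<eta>. \<eta> \<in> cbox 0 1 \<Longrightarrow> \<bar>pg \<eta>\<bar> \<le> 7"
      using affine[OF g] by blast
    have W_eq: "W \<eta> = (Q$1 - P$1) + y1 \<eta> *\<^sub>R (Q$2 - Q$1) + y2 \<eta> *\<^sub>R (Q$3 - Q$2)
        - (x1 \<eta> *\<^sub>R (P$2 - P$1) + x2 \<eta> *\<^sub>R (P$3 - P$2) + x3 \<eta> *\<^sub>R (P$4 - P$2))" for \<eta>
      by (simp add: W_def X_def tri_map_eq tet_map_eq)
    have W_poly: "coord_poly 4 (\<lambda>\<eta>. W \<eta> $ i)" for i
      unfolding W_eq vector_minus_component vector_add_component vector_scaleR_component real_scaleR_def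
      by (intro coord_poly_diff coord_poly.add coord_poly_const coord_poly_scale_right poly)
    have W_le: "norm (W \<eta>) \<le> 6 * \<kappa> * h" if "\<eta> \<in> cbox 0 1" for \<eta>
    proof -
      have scal: "norm (t *\<^sub>R v) \<le> \<kappa> * h" if "\<bar>t\<bar> \<le> 1" "norm v \<le> \<kappa> * h" for t and v :: "real^3"
        using mult_mono[OF that] by simp
      note u = unit[OF that]
      have "norm (v1 + v2 + v3 - (v4 + v5 + v6)) \<le> norm v1 + norm v2 + norm v3 + (norm v4 + norm v5 + norm v6)"
        for v1 v2 v3 v4 v5 v6 :: "real^3"
        by (intro order_trans[OF norm_triangle_ineq4] add_mono norm_triangle_le order_refl)
      then have "norm (W \<eta>) \<le> \<kappa> * h + \<kappa> * h + \<kappa> * h + (\<kappa> * h + \<kappa> * h + \<kappa> * h)"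
        unfolding W_eq
        by (rule order_trans) (intro add_mono scal u edges)
      then show ?thesis by simp
    qed
    have W_ge: "m * h \<le> norm (W \<eta>)" if "\<eta> \<in> cbox 0 1" for \<eta>
      using lower[OF that] by (simp add: W_def X_def)
    have D_le: "D \<le> \<kappa> ^ 5 * h ^ 5"
    proof -
      have "\<bar>det (tet_matrix P)\<bar> \<le> (\<kappa> * h) * ((\<kappa> * h) * (\<kappa> * h))"
        unfolding det_tet_matrix using edges assms h
        by (intro order_trans[OF abs_triple_le] mult_mono) auto
      moreover have "norm (cross3 (Q$2 - Q$1) (Q$3 - Q$2)) \<le> (\<kappa> * h) * (\<kappa> * h)"
        using edges assms h by (intro order_trans[OF norm_cross3_le] mult_mono) auto
      ultimately have "D \<le> ((\<kappa> * h) * ((\<kappa> * h) * (\<kappa> * h))) * ((\<kappa> * h) * (\<kappa> * h))"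
        unfolding D_def using assms h by (intro mult_mono) auto
      then show ?thesis
        by (simp add: eval_nat_numeral mult_ac)
    qed
    define A where "A \<eta> = 1 / (B * h ^ 6) * (pf \<eta> * pg \<eta> * (W \<eta> \<bullet> \<nu>) * J \<eta> * D)" for \<eta>
    define r where "r \<eta> = 1 / (R * h)\<^sup>2 * (W \<eta> \<bullet> W \<eta>)" for \<eta>
    have "coord_poly 20 A"
      unfolding A_def inner_vec_def inner_real_def
      by (rule coord_poly_mono[of "((4 + 4) + 4) + 4"])
         (intro coord_poly.scale coord_poly_scale_right coord_poly_mult coord_poly_sum pf pg poly W_poly, simp)
    moreover have "coord_poly 20 r"
      unfolding r_def inner_vec_def inner_real_def
      by (rule coord_poly_mono[of "4 + 4"])
         (intro coord_poly.scale coord_poly_mult coord_poly_sum W_poly, simp)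
    moreover have "\<bar>A \<eta>\<bar> \<le> 1 \<and> \<delta> \<le> r \<eta> \<and> r \<eta> \<le> 1" if \<eta>: "\<eta> \<in> cbox 0 1" for \<eta>
    proof (intro conjI)
      have W\<nu>: "\<bar>W \<eta> \<bullet> \<nu>\<bar> \<le> 6 * \<kappa> * h"
        using Cauchy_Schwarz_ineq2[of "W \<eta>" \<nu>] W_le[OF \<eta>] \<nu> by simp
      have D_abs: "\<bar>D\<bar> \<le> \<kappa> ^ 5 * h ^ 5"
        using D_le by (simp add: D_def)
      have "\<bar>pf \<eta>\<bar> * \<bar>pg \<eta>\<bar> * \<bar>W \<eta> \<bullet> \<nu>\<bar> * \<bar>J \<eta>\<bar> * \<bar>D\<bar>
          \<le> 7 * 7 * (6 * \<kappa> * h) * 1 * (\<kappa> ^ 5 * h ^ 5)"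
        by (intro mult_mono pf(3)[OF \<eta>] pg(3)[OF \<eta>] W\<nu> unit(6)[OF \<eta>] D_abs
            mult_nonneg_nonneg abs_ge_zero) (use assms h in simp_all)
      also have "\<dots> = B * h ^ 6"
        by (simp add: B_def eval_nat_numeral mult_ac)
      finally have le: "\<bar>pf \<eta>\<bar> * \<bar>pg \<eta>\<bar> * \<bar>W \<eta> \<bullet> \<nu>\<bar> * \<bar>J \<eta>\<bar> * \<bar>D\<bar> \<le> B * h ^ 6" .
      have Bh: "0 < B * h ^ 6"
        using B h by simp
      have "\<bar>A \<eta>\<bar> = \<bar>pf \<eta>\<bar> * \<bar>pg \<eta>\<bar> * \<bar>W \<eta> \<bullet> \<nu>\<bar> * \<bar>J \<eta>\<bar> * \<bar>D\<bar> / \<bar>B * h ^ 6\<bar>"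
        unfolding A_def abs_mult[symmetric] by (simp only: times_divide_eq_left mult_1 abs_divide)
      also have "\<dots> \<le> 1"
        using le Bh by (simp only: abs_of_pos divide_le_eq_1_pos)
      finally show "\<bar>A \<eta>\<bar> \<le> 1" .
      have r: "r \<eta> = (norm (W \<eta>) / (R * h))\<^sup>2"
        by (simp add: r_def power2_norm_eq_inner power_divide)
      have "m / R \<le> norm (W \<eta>) / (R * h)"
        using W_ge[OF \<eta>] R h by (simp add: field_simps)
      then have "(m / R)\<^sup>2 \<le> r \<eta>"
        unfolding r using assms R by (intro power_mono) auto
      then show "\<delta> \<le> r \<eta>"
        by (simp add: \<delta>_def)
      have "norm (W \<eta>) \<le> R * h"
        using W_le[OF \<eta>] mult_pos_pos[OF assms(1) h] by (simp add: R_def)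
      then show "r \<eta> \<le> 1"
        unfolding r using R h by (intro power_le_one) auto
    qed
    ultimately have "cube_approximable n (C * q ^ n) (\<lambda>\<eta>. A \<eta> * r \<eta> powr a)"
      by (rule approx)
    from cube_approximable_scale[OF this, of "B * h ^ 6 * (R * h) powr (- (3 + 2 * s))"]
    have ap: "cube_approximable n (B * h ^ 6 * (R * h) powr (- (3 + 2 * s)) * (C * q ^ n))
        (\<lambda>\<eta>. B * h ^ 6 * (R * h) powr (- (3 + 2 * s)) * (A \<eta> * r \<eta> powr a))"
      using B h by simp
    have const: "B * h ^ 6 * (R * h) powr (- (3 + 2 * s)) * (C * q ^ n) = C' * h powr (3 - 2 * s) * q ^ n"
    proof -
      have "h ^ 6 = h powr 6"
        using h by simp
      then have "h ^ 6 * h powr (- (3 + 2 * s)) = h powr (6 + - (3 + 2 * s))"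
        by (simp only: powr_add)
      then have "h ^ 6 * h powr (- (3 + 2 * s)) = h powr (3 - 2 * s)"
        by simp
      then show ?thesis
        using R h by (simp add: C'_def powr_mult mult_ac)
    qed
    have eq: "B * h ^ 6 * (R * h) powr (- (3 + 2 * s)) * (A \<eta> * r \<eta> powr a)
        = kernel2 s f g P Q \<nu> (vector [x1 \<eta>, x2 \<eta>, x3 \<eta>]) (vector [y1 \<eta>, y2 \<eta>]) * J \<eta>"
      if \<eta>: "\<eta> \<in> cbox 0 1" for \<eta>
    proof -
      have Wpos: "0 < norm (W \<eta>)"
        using W_ge[OF \<eta>] assms h by (smt (verit) mult_pos_pos)
      have "r \<eta> = (norm (W \<eta>) / (R * h)) powr 2"
        using Wpos R h by (simp add: r_def power2_norm_eq_inner power_divide)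
      then have "r \<eta> powr a = (norm (W \<eta>) / (R * h)) powr (- (3 + 2 * s))"
        by (simp add: powr_powr a_def diff_divide_distrib)
      also have "\<dots> = norm (W \<eta>) powr (- (3 + 2 * s)) / (R * h) powr (- (3 + 2 * s))"
        using Wpos R h by (simp add: powr_divide)
      finally have "(R * h) powr (- (3 + 2 * s)) * r \<eta> powr a = norm (W \<eta>) powr (- (3 + 2 * s))"
        using R h by simp
      then have "(R * h) powr (- (3 + 2 * s)) * r \<eta> powr a = 1 / norm (W \<eta>) powr (3 + 2 * s)"
        by (simp only: powr_minus_divide)
      moreover have "B * h ^ 6 * A \<eta> = pf \<eta> * pg \<eta> * (W \<eta> \<bullet> \<nu>) * J \<eta> * D"
        using B h by (simp add: A_def)
      moreover have "B * h ^ 6 * (R * h) powr (- (3 + 2 * s)) * (A \<eta> * r \<eta> powr a)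
          = (B * h ^ 6 * A \<eta>) * ((R * h) powr (- (3 + 2 * s)) * r \<eta> powr a)"
        by (simp only: mult_ac)
      ultimately have "B * h ^ 6 * (R * h) powr (- (3 + 2 * s)) * (A \<eta> * r \<eta> powr a)
          = pf \<eta> * pg \<eta> * (W \<eta> \<bullet> \<nu>) * J \<eta> * D * (1 / norm (W \<eta>) powr (3 + 2 * s))"
        by (simp only:)
      then show ?thesis
        using pf(2)[OF \<eta>] pg(2)[OF \<eta>]
        by (simp add: kernel2_def W_def[symmetric] X_def[symmetric] D_def mult_ac)
    qed
    show ?thesis
      unfolding const[symmetric] by (rule cube_approximable_cong[OF ap eq])
  qed
  have "0 < C'"
    using C B R by (simp add: C'_def)
  then show thesis
    by (rule that[OF _ q main])
qed

section \<open>Shape regularity\<close>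

lemma vec_angle_gt_imp_inner_le:
  assumes "0 \<le> \<theta>" "\<theta> < vec_angle x y"
  shows "x \<bullet> y \<le> cos \<theta> * (norm x * norm y)"
proof (cases "norm x * norm y = 0")
  case False
  then have pos: "0 < norm x * norm y" by auto
  define z where "z = (x \<bullet> y) / (norm x * norm y)"
  have z: "- 1 \<le> z" "z \<le> 1"
    using Cauchy_Schwarz_ineq2[of x y] pos by (auto simp: z_def field_simps abs_le_iff)
  have "\<theta> < arccos z"
    using assms(2) by (simp add: vec_angle_def z_def)
  then have "cos (arccos z) < cos \<theta>"
    using assms(1) arccos_bounded[OF z] by (intro cos_monotone_0_pi) auto
  then have "z < cos \<theta>"
    using z by simp
  then show ?thesis
    using pos by (simp add: z_def field_simps)
qed auto

lemma cross3_lagrange: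
  "cross3 x y \<bullet> cross3 z w = (x \<bullet> z) * (y \<bullet> w) - (x \<bullet> w) * (y \<bullet> z)"
  by (simp add: cross3_simps)

text \<open>Crossing with \<open>e\<close> rotates the component orthogonal to \<open>e\<close> by a
  right angle and stretches it by \<open>norm e\<close>.\<close>

lemma inner_cross3_reject_along:
  assumes "e \<noteq> 0"
  shows "cross3 e p \<bullet> cross3 e q = (e \<bullet> e) * (reject_along e p \<bullet> reject_along e q)"
  using assms
  by (simp add: cross3_lagrange reject_along_def inner_diff_left inner_diff_right inner_commute field_simps)

text \<open>A lower bound on an angle bounds its sine only if the angle is not obtuse. Therefore the
  angles at the vertices 0 and \<open>p\<close> of the triangle 0, \<open>p\<close>,
  \<open>q\<close> are both used; they cannot both be obtuse. Here \<open>c\<close> stands for a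
  cosine and \<open>\<sigma>\<close> for the sine.\<close>

lemma cross3_lower_bound:
  fixes p q :: "real^3"
  assumes "p \<bullet> q \<le> c * (norm p * norm q)" "- p \<bullet> (q - p) \<le> c * (norm p * norm (q - p))"
    and "0 < \<sigma>" "\<sigma>\<^sup>2 + c\<^sup>2 = 1"
  shows "\<sigma> * (norm p * norm q) \<le> norm (cross3 p q)"
proof -
  have acute: "\<sigma> * (norm p * norm r) \<le> norm (cross3 p r)"
    if "\<bar>p \<bullet> r\<bar> \<le> c * (norm p * norm r)" for r
  proof -
    have "(p \<bullet> r)\<^sup>2 \<le> (c * (norm p * norm r))\<^sup>2"
      using that by (metis abs_ge_zero power2_abs power_mono)
    moreover have "(\<sigma> * (norm p * norm r))\<^sup>2 + (c * (norm p * norm r))\<^sup>2 = (norm p * norm r)\<^sup>2"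
      using assms(4) by (metis power_mult_distrib distrib_right mult_1)
    ultimately have "(\<sigma> * (norm p * norm r))\<^sup>2 \<le> (norm (cross3 p r))\<^sup>2"
      using norm_cross_dot[of p r] by linarith
    then show ?thesis
      by (rule power2_le_imp_le) simp
  qed
  show ?thesis
  proof (cases "0 \<le> p \<bullet> q")
    case True
    then show ?thesis
      using assms(1) by (intro acute) simp
  next
    case False
    \<comment> \<open>The angle at 0 is obtuse, so the opposite side \<open>q - p\<close> is longer
      than \<open>q\<close>, while the cross product with \<open>p\<close> is unchanged.\<close>
    have eq: "(norm (q - p))\<^sup>2 = (norm p)\<^sup>2 + (norm q)\<^sup>2 - 2 * (p \<bullet> q)"
      by (simp add: power2_norm_eq_inner inner_diff_left inner_diff_right inner_commute)
    then have "(norm q)\<^sup>2 \<le> (norm (q - p))\<^sup>2"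
      using False zero_le_power2[of "norm p"] by linarith
    then have "norm q \<le> norm (q - p)"
      by (rule power2_le_imp_le) simp
    then have "\<sigma> * (norm p * norm q) \<le> \<sigma> * (norm p * norm (q - p))"
      using assms(3) by (intro mult_left_mono) auto
    also have "\<dots> \<le> norm (cross3 p (q - p))"
      using assms(2) False inner_ge_zero[of p] by (intro acute) (simp add: inner_diff_right del: inner_ge_zero)
    also have "cross3 p (q - p) = cross3 p q"
      by (simp add: cross3_simps)
    finally show ?thesis .
  qed
qed

text \<open>The vectors \<open>cross3 e p\<close> and \<open>cross3 e q\<close> are normals of the
  two faces through \<open>e\<close>. The sine of their angle appears in their cross product, which
  is the triple product times \<open>e\<close>.\<close>

lemma triple_product_lower_bound:
  fixes e p q :: "real^3"
  assumes "0 \<le> cross3 e p \<bullet> cross3 e q"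
    and "cross3 e p \<bullet> cross3 e q \<le> c * (norm (cross3 e p) * norm (cross3 e q))"
    and "0 < \<sigma>" "\<sigma>\<^sup>2 + c\<^sup>2 = 1"
  shows "\<sigma> * (norm (cross3 e p) * norm (cross3 e q)) \<le> norm e * \<bar>e \<bullet> cross3 p q\<bar>"
proof -
  let ?X = "norm (cross3 e p) * norm (cross3 e q)"
  have "(cross3 e p \<bullet> cross3 e q)\<^sup>2 \<le> (c * ?X)\<^sup>2"
    using assms(1,2) by (intro power_mono)
  moreover have "(\<sigma> * ?X)\<^sup>2 + (c * ?X)\<^sup>2 = ?X\<^sup>2"
    using assms(4) by (metis power_mult_distrib distrib_right mult_1)
  moreover have "cross3 (cross3 e p) (cross3 e q) = (e \<bullet> cross3 p q) *\<^sub>R e"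
    using cross_cross_det[of e p e q] by (simp add: dot_cross_det[symmetric] dot_cross_self)
  ultimately have "(\<sigma> * ?X)\<^sup>2 \<le> (norm e * \<bar>e \<bullet> cross3 p q\<bar>)\<^sup>2"
    using norm_cross_dot[of "cross3 e p" "cross3 e q"]
    by (simp add: mult.commute[of "norm e"])
  then show ?thesis
    by (rule power2_le_imp_le) simp
qed

text \<open>In every face some edge has an acute dihedral angle, since the fourth vertex projects to the
  inner side of some edge. A lower bound on dihedral angles thus suffices, without an upper bound.\<close>

lemma tetrahedron_volume_bound:
  fixes V :: "(real^3) set"
  assumes V: "V = {a, b, c, d}" "distinct [a, b, c, d]"
    and face: "\<And>u v w. {u, v, w} \<subseteq> V \<Longrightarrow> distinct [u, v, w] \<Longrightarrow>
      (u - v) \<bullet> (w - v) \<le> \<gamma> * (norm (u - v) * norm (w - v))"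
    and dihedral: "\<And>u v w z. {u, v, w, z} \<subseteq> V \<Longrightarrow> distinct [u, v, w, z] \<Longrightarrow>
      reject_along (v - u) (w - u) \<bullet> reject_along (v - u) (z - u)
        \<le> \<gamma> * (norm (reject_along (v - u) (w - u)) * norm (reject_along (v - u) (z - u)))"
    and \<sigma>: "0 < \<sigma>" "\<sigma>\<^sup>2 + \<gamma>\<^sup>2 = 1"
    and D: "u0 \<in> V" "v0 \<in> V" "u0 \<noteq> v0"
  shows "\<sigma> ^ 9 * norm (u0 - v0) ^ 3 \<le> \<bar>(b - a) \<bullet> cross3 (c - a) (d - a)\<bar>"
proof -
  have \<sigma>1: "\<sigma> \<le> 1"
  proof (rule power2_le_imp_le)
    show "\<sigma>\<^sup>2 \<le> 1\<^sup>2"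
      using \<sigma> zero_le_power2[of \<gamma>] unfolding one_power2 by linarith
  qed simp
  have cross: "\<sigma> * (norm (v - u) * norm (w - u)) \<le> norm (cross3 (v - u) (w - u))"
    if "{u, v, w} \<subseteq> V" "distinct [u, v, w]" for u v w
    using face[of v u w] face[of u v w] that
    by (intro cross3_lower_bound[OF _ _ \<sigma>]) (auto simp: norm_minus_commute)
  \<comment> \<open>Law of sines in the triangle \<open>u\<close>, \<open>v\<close>,
    \<open>w\<close>, with the angle at \<open>w\<close>.\<close>
  have ratio: "\<sigma> * norm (w - u) \<le> norm (v - u)" if "u \<in> V" "v \<in> V" "w \<in> V" "u \<noteq> v" "u \<noteq> w" for u v w
  proof (cases "v = w")
    case True
    then show ?thesis
      using \<sigma>1 by (simp add: mult_left_le_one_le \<sigma>(1) less_imp_le)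
  next
    case False
    have "\<sigma> * (norm (u - w) * norm (v - w)) \<le> norm (cross3 (u - w) (v - w))"
      using cross[of w u v] that False by auto
    also have "cross3 (u - w) (v - w) = cross3 (u - v) (v - w)"
      by (simp add: cross3_simps)
    also have "norm \<dots> \<le> norm (u - v) * norm (v - w)"
      by (rule norm_cross3_le)
    finally show ?thesis
      using False by (simp add: norm_minus_commute)
  qed
  \<comment> \<open>Any two edges are linked by at most two comparisons of edges with a common
    vertex, hence the square.\<close>
  have edge: "\<sigma>\<^sup>2 * norm (u0 - v0) \<le> norm (v - u)" if "u \<in> V" "v \<in> V" "u \<noteq> v" for u v
  proof (cases "u = u0")
    case True
    have "\<sigma>\<^sup>2 * norm (u0 - v0) \<le> \<sigma> * norm (u0 - v0)"
      using \<sigma>1 \<sigma>(1) by (intro mult_right_mono) (auto simp: power2_eq_square)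
    also have "\<dots> \<le> norm (v - u)"
      using ratio[of u v v0] that D True by (simp add: norm_minus_commute)
    finally show ?thesis .
  next
    case False
    have "\<sigma>\<^sup>2 * norm (u0 - v0) = \<sigma> * (\<sigma> * norm (v0 - u0))"
      by (simp add: power2_eq_square norm_minus_commute)
    also have "\<dots> \<le> \<sigma> * norm (u - u0)"
      using ratio[of u0 u v0] that D False \<sigma> by (intro mult_left_mono) auto
    also have "\<dots> \<le> norm (v - u)"
      using ratio[of u v u0] that D False by (simp add: norm_minus_commute)
    finally show ?thesis .
  qed
  \<comment> \<open>The exponent 9: one sine for the dihedral angle, two for the faces, and two for
    each of three edges.\<close>
  have key: "\<sigma> ^ 9 * norm (u0 - v0) ^ 3 \<le> \<bar>(v - u) \<bullet> cross3 (w - u) (z - u)\<bar>"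
    if uvwz: "{u, v, w, z} \<subseteq> V" "distinct [u, v, w, z]"
      and pos: "0 < cross3 (v - u) (w - u) \<bullet> cross3 (v - u) (z - u)" for u v w z
  proof -
    let ?e = "v - u" and ?p = "w - u" and ?q = "z - u"
    have e: "?e \<noteq> 0" using uvwz by auto
    have norm_reject: "norm (cross3 ?e x) = norm ?e * norm (reject_along ?e x)" for x
      using inner_cross3_reject_along[OF e, of x x]
      by (simp add: norm_eq_sqrt_inner real_sqrt_mult)
    have "cross3 ?e ?p \<bullet> cross3 ?e ?q \<le> \<gamma> * (norm (cross3 ?e ?p) * norm (cross3 ?e ?q))"
      using mult_left_mono[OF dihedral[OF uvwz], of "?e \<bullet> ?e"]
      unfolding norm_reject inner_cross3_reject_along[OF e]
      by (simp add: power2_norm_eq_inner[symmetric] power2_eq_square mult_ac)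
    then have "\<sigma> * (norm (cross3 ?e ?p) * norm (cross3 ?e ?q)) \<le> norm ?e * \<bar>?e \<bullet> cross3 ?p ?q\<bar>"
      using pos by (intro triple_product_lower_bound[OF _ _ \<sigma>]) auto
    moreover have "\<sigma> * ((\<sigma> * (norm ?e * norm ?p)) * (\<sigma> * (norm ?e * norm ?q)))
        \<le> \<sigma> * (norm (cross3 ?e ?p) * norm (cross3 ?e ?q))"
      using cross[of u v w] cross[of u v z] uvwz \<sigma> by (intro mult_left_mono mult_mono) auto
    ultimately have "norm ?e * (\<sigma> ^ 3 * (norm ?e * (norm ?p * norm ?q))) \<le> norm ?e * \<bar>?e \<bullet> cross3 ?p ?q\<bar>"
      by (simp add: eval_nat_numeral mult_ac)
    then have "\<sigma> ^ 3 * (norm ?e * (norm ?p * norm ?q)) \<le> \<bar>?e \<bullet> cross3 ?p ?q\<bar>"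
      using e by simp
    moreover have "\<sigma> ^ 3 * ((\<sigma>\<^sup>2 * norm (u0 - v0)) * ((\<sigma>\<^sup>2 * norm (u0 - v0)) * (\<sigma>\<^sup>2 * norm (u0 - v0))))
        \<le> \<sigma> ^ 3 * (norm ?e * (norm ?p * norm ?q))"
      using \<sigma> uvwz by (intro mult_left_mono mult_mono edge) auto
    moreover have "\<sigma> ^ 3 * ((\<sigma>\<^sup>2 * norm (u0 - v0)) * ((\<sigma>\<^sup>2 * norm (u0 - v0)) * (\<sigma>\<^sup>2 * norm (u0 - v0))))
        = \<sigma> ^ 9 * norm (u0 - v0) ^ 3"
      by (simp add: eval_nat_numeral mult_ac)
    ultimately show ?thesis by linarith
  qed
  let ?N = "cross3 (b - a) (c - a)"
  have "0 < \<sigma> * (norm (b - a) * norm (c - a))"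
    using V \<sigma> by auto
  also have "\<dots> \<le> norm ?N"
    using cross[of a b c] V by auto
  finally have "0 < ?N \<bullet> ?N" by simp
  \<comment> \<open>The oriented area vectors of a closed surface cancel. Since their sum is
    \<open>?N\<close>, one of the three other faces has a normal with positive component along
    \<open>?N\<close>.\<close>
  also have "?N \<bullet> ?N = ?N \<bullet> (cross3 (b - a) (d - a) + cross3 (c - b) (d - b) + cross3 (a - c) (d - c))"
    by (rule arg_cong[of _ _ "\<lambda>x. ?N \<bullet> x"]) (simp add: cross3_simps)
  finally consider "0 < ?N \<bullet> cross3 (b - a) (d - a)" | "0 < ?N \<bullet> cross3 (c - b) (d - b)"
    | "0 < ?N \<bullet> cross3 (a - c) (d - c)"
    by (fastforce simp: inner_add_right)
  then show ?thesis
  proof cases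
    case 1
    then show ?thesis
      using key[of a b c d] V by auto
  next
    case 2
    have "?N = cross3 (c - b) (a - b)"
      "(b - a) \<bullet> cross3 (c - a) (d - a) = (c - b) \<bullet> cross3 (a - b) (d - b)"
      by (simp_all add: cross3_simps)
    then show ?thesis
      using key[of b c a d] V 2 by auto
  next
    case 3
    have "?N = cross3 (a - c) (b - c)"
      "(b - a) \<bullet> cross3 (c - a) (d - a) = (a - c) \<bullet> cross3 (b - c) (d - c)"
      by (simp_all add: cross3_simps)
    then show ?thesis
      using key[of c a b d] V 3 by auto
  qed
qed

section \<open>Mesh geometry\<close>

text \<open>The affinely independent points \<open>C\<close> are extreme points of the hull, and
  those must occur among the points listed by \<open>P\<close>. Equal counts leave no room for
  repetitions.\<close>

lemma conv_vertices:
  fixes P :: "real^3^'k"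
  assumes "\<not> affine_dependent C" "card C = CARD('k)" "conv P = convex hull C"
  shows "range (($) P) = C" "inj (($) P)"
proof -
  have "C \<subseteq> range (($) P)"
  proof
    fix x assume "x \<in> C"
    then have "x extreme_point_of (convex hull range (($) P))"
      using assms extreme_point_of_convex_hull_affine_independent[of C x] by (simp add: conv_def)
    then show "x \<in> range (($) P)"
      by (rule extreme_point_of_convex_hull)
  qed
  moreover have "card (range (($) P)) \<le> card C"
    using assms(2) by (simp add: card_image_le)
  ultimately show eq: "range (($) P) = C"
    using card_seteq[of "range (($) P)" C] by simp
  then show "inj (($) P)"
    using assms(2) by (intro eq_card_imp_inj_on) auto
qed

lemma simplex_conv_vertices:
  fixes P :: "real^3^4"
  assumes "3 simplex (conv P)"
  shows "\<not> affine_dependent (range (($) P))" "inj (($) P)"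
    and "{p. p extreme_point_of conv P} = range (($) P)"
proof -
  obtain C where C: "\<not> affine_dependent C" "int (card C) = 3 + 1" "conv P = convex hull C"
    using assms by (auto simp: simplex_def)
  have "card C = CARD(4)"
    using C(2) by simp
  note P = conv_vertices[OF C(1) this C(3)]
  show "\<not> affine_dependent (range (($) P))" "inj (($) P)"
    using P C by auto
  show "{p. p extreme_point_of conv P} = range (($) P)"
    using C(1,3) P(1) by (auto simp: extreme_point_of_convex_hull_affine_independent)
qed

text \<open>A facet is spanned by three of the four vertices. Completing \<open>Q\<close> to an
  ordering of the whole tetrahedron lets volume bounds be transferred to panels.\<close>

lemma panel_conv_vertices:
  fixes Q :: "real^3^3"
  assumes "3 simplex t" "conv Q facet_of t"
  shows "\<not> affine_dependent (range (($) Q))"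
    and "\<exists>P :: real^3^4. conv P = t \<and> P$1 = Q$1 \<and> P$2 = Q$2 \<and> P$3 = Q$3"
proof -
  obtain C where C: "finite C" "\<not> affine_dependent C" "int (card C) = 3 + 1" "t = convex hull C"
    using assms by (auto simp: simplex)
  obtain c where c: "c \<subseteq> C" "conv Q = convex hull c"
    using assms(2) C(2,4) by (auto simp: facet_of_def face_of_convex_hull_affine_independent)
  have ind: "\<not> affine_dependent c"
    using C(2) c(1) affine_dependent_subset by blast
  have "aff_dim (conv Q) = 2"
    using assms(2) C by (auto simp: facet_of_def aff_dim_convex_hull aff_dim_affine_independent)
  then have "card c = CARD(3)"
    using aff_dim_affine_independent[OF ind] c(2) by (simp add: aff_dim_convex_hull)
  note Q = conv_vertices[OF ind this c(2)]
  show "\<not> affine_dependent (range (($) Q))"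
    using Q ind by auto
  have "card (C - c) = 1"
    using C c \<open>card c = CARD(3)\<close> by (simp add: card_Diff_subset finite_subset[OF c(1)])
  then obtain e where e: "C - c = {e}"
    by (auto simp: card_1_singleton_iff)
  define P :: "real^3^4" where
    "P = (\<chi> k. if k = 1 then Q$1 else if k = 2 then Q$2 else if k = 3 then Q$3 else e)"
  have "range (($) P) = {Q$1, Q$2, Q$3, e}"
    unfolding UNIV_4 by (auto simp: P_def)
  also have "\<dots> = range (($) Q) \<union> {e}"
    unfolding UNIV_3 by auto
  also have "\<dots> = C"
    using e c(1) Q(1) by auto
  finally have "conv P = t"
    by (simp add: conv_def C(4))
  then show "\<exists>P :: real^3^4. conv P = t \<and> P$1 = Q$1 \<and> P$2 = Q$2 \<and> P$3 = Q$3"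
    by (intro exI[of _ P]) (simp add: P_def)
qed

lemma compact_conv: "compact (conv P)"
  by (simp add: conv_def finite_imp_compact_convex_hull)

lemma vertex_in_conv: "P$i \<in> conv P"
  by (simp add: conv_def hull_inc)

lemma norm_edge_le_diameter: "norm (P$i - P$j) \<le> diameter (conv P)"
  using diameter_bounded_bound[OF compact_imp_bounded[OF compact_conv] vertex_in_conv vertex_in_conv]
  by (simp add: dist_norm)

lemma diameter_conv_attained: "\<exists>i j. diameter (conv P) \<le> norm (P$i - P$j)"
proof -
  obtain i j where ij: "\<forall>x\<in>conv P. \<forall>y\<in>conv P. norm (x - y) \<le> norm (P$i - P$j)"
    using simplex_extremal_le[of "range (($) P)"] by (auto simp: conv_def)
  have "diameter (conv P) \<le> norm (P$i - P$j)"
    using ij by (intro diameter_le) auto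
  then show ?thesis by blast
qed

lemma det_tet_matrix_lower_bound:
  assumes "0 < \<theta>"
  shows "\<exists>\<mu>>0. \<forall>\<T> P. shape_regular \<theta> \<T> \<and> conv P \<in> \<T> \<and> 3 simplex (conv P) \<longrightarrow>
    \<mu> * diameter (conv P) ^ 3 \<le> \<bar>det (tet_matrix P)\<bar>"
proof -
  \<comment> \<open>The cutoff keeps the angle in the range where the sine is positive.\<close>
  define \<theta>' where "\<theta>' = min \<theta> 1"
  define \<sigma> where "\<sigma> = sin \<theta>'"
  have \<theta>': "0 < \<theta>'" "\<theta>' \<le> 1" "\<theta>' \<le> \<theta>"
    using assms by (auto simp: \<theta>'_def)
  have \<sigma>: "0 < \<sigma>" "\<sigma>\<^sup>2 + (cos \<theta>')\<^sup>2 = 1"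
    using \<theta>' pi_gt3 by (auto simp: \<sigma>_def intro!: sin_gt_zero)
  have "\<sigma> ^ 9 * diameter (conv P) ^ 3 \<le> \<bar>det (tet_matrix P)\<bar>"
    if sr: "shape_regular \<theta> \<T>" and P: "conv P \<in> \<T>" "3 simplex (conv P)" for \<T> P
  proof -
    let ?V = "range (($) P)"
    note vert = simplex_conv_vertices[OF P(2)]
    have V: "?V = {P$1, P$2, P$3, P$4}"
      unfolding UNIV_4 by auto
    have dist: "distinct [P$1, P$2, P$3, P$4]"
      using vert(2) by (auto simp: inj_eq)
    have face: "(u - v) \<bullet> (w - v) \<le> cos \<theta>' * (norm (u - v) * norm (w - v))"
      if "{u, v, w} \<subseteq> ?V" "distinct [u, v, w]" for u v w
    proof -
      have "vec_angle (u - v) (w - v) \<in> face_angles (conv P)"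
        unfolding face_angles_def vert(3) using that by blast
      then have "\<theta>' < vec_angle (u - v) (w - v)"
        using sr P(1) \<theta>'(3) unfolding shape_regular_def by (meson UnCI order_le_less_trans)
      then show ?thesis
        using \<theta>'(1) by (intro vec_angle_gt_imp_inner_le) auto
    qed
    have dihedral: "reject_along (v - u) (w - u) \<bullet> reject_along (v - u) (z - u)
        \<le> cos \<theta>' * (norm (reject_along (v - u) (w - u)) * norm (reject_along (v - u) (z - u)))"
      if "{u, v, w, z} \<subseteq> ?V" "distinct [u, v, w, z]" for u v w z
    proof -
      have "vec_angle (reject_along (v - u) (w - u)) (reject_along (v - u) (z - u)) \<in> dihedral_angles (conv P)"
        unfolding dihedral_angles_def vert(3) using that by blast
      then have "\<theta>' < vec_angle (reject_along (v - u) (w - u)) (reject_along (v - u) (z - u))"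
        using sr P(1) \<theta>'(3) unfolding shape_regular_def by (meson UnCI order_le_less_trans)
      then show ?thesis
        using \<theta>'(1) by (intro vec_angle_gt_imp_inner_le) auto
    qed
    obtain i j where ij: "diameter (conv P) \<le> norm (P$i - P$j)"
      using diameter_conv_attained by blast
    have "P$1 \<noteq> P$2" using dist by simp
    then have "0 < norm (P$1 - P$2)" by simp
    also have "\<dots> \<le> norm (P$i - P$j)"
      using norm_edge_le_diameter[of P 1 2] ij by linarith
    finally have ne: "P$i \<noteq> P$j" by auto
    have diam0: "0 \<le> diameter (conv P)"
      using norm_edge_le_diameter[of P 1 2] norm_ge_zero order_trans by blast
    have "\<sigma> ^ 9 * diameter (conv P) ^ 3 \<le> \<sigma> ^ 9 * norm (P$i - P$j) ^ 3"
      using ij diam0 \<sigma>(1) by (intro mult_left_mono power_mono) auto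
    also have "\<dots> \<le> \<bar>(P$2 - P$1) \<bullet> cross3 (P$3 - P$1) (P$4 - P$1)\<bar>"
      using ne by (intro tetrahedron_volume_bound[OF V dist face dihedral \<sigma>]) auto
    also have "(P$2 - P$1) \<bullet> cross3 (P$3 - P$1) (P$4 - P$1) = det (tet_matrix P)"
      unfolding det_tet_matrix by (simp add: cross3_simps)
    finally show ?thesis .
  qed
  then show ?thesis
    using \<sigma>(1) by (intro exI[of _ "\<sigma> ^ 9"]) auto
qed

lemma mesh_size_bounds:
  assumes "regular_partition \<Omega> \<T>" "quasi_uniform c1 c2 \<T>" "t \<in> \<T>"
  shows "c1 * diameter t \<le> mesh_size \<T>" "mesh_size \<T> \<le> c2 * diameter t"
proof -
  have fin: "finite \<T>"
    using assms(1) by (simp add: regular_partition_def triangulation_def)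
  then have card: "0 < real (card \<T>)"
    using assms(3) by (auto simp: card_gt_0_iff)
  have bnd: "c1 * diameter t \<le> diameter t'" "diameter t' \<le> c2 * diameter t" if "t' \<in> \<T>" for t'
    using assms(2,3) that by (auto simp: quasi_uniform_def)
  have "real (card \<T>) * (c1 * diameter t) \<le> (\<Sum>t'\<in>\<T>. diameter t')"
    using bnd(1) by (intro sum_bounded_below) auto
  then show "c1 * diameter t \<le> mesh_size \<T>"
    using card by (simp add: mesh_size_def field_simps)
  have "(\<Sum>t'\<in>\<T>. diameter t') \<le> real (card \<T>) * (c2 * diameter t)"
    using bnd(2) by (intro sum_bounded_above) auto
  then show "mesh_size \<T> \<le> c2 * diameter t"
    using card by (simp add: mesh_size_def field_simps)
qed

lemma mesh_scaling:
  assumes "0 < \<theta>" "0 < c1" "0 < c2"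
  shows "\<exists>\<kappa> \<mu>. 1 \<le> \<kappa> \<and> 0 < \<mu> \<and> (\<forall>\<Omega> \<T>. regular_partition \<Omega> \<T> \<and> shape_regular \<theta> \<T> \<and> quasi_uniform c1 c2 \<T> \<longrightarrow>
    (\<forall>P. conv P \<in> \<T> \<longrightarrow> 0 < mesh_size \<T> \<and> diameter (conv P) \<le> \<kappa> * mesh_size \<T> \<and>
       \<mu> * mesh_size \<T> ^ 3 \<le> \<bar>det (tet_matrix P)\<bar>) \<and>
    (\<forall>Q :: real^3^3. conv Q \<in> panels \<T> \<longrightarrow> diameter (conv Q) \<le> \<kappa> * mesh_size \<T> \<and>
       \<mu> * (mesh_size \<T>)\<^sup>2 \<le> norm (cross3 (Q$2 - Q$1) (Q$3 - Q$2))))"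
proof -
  obtain \<mu>0 where \<mu>0: "0 < \<mu>0" and det: "\<And>\<T> P. shape_regular \<theta> \<T> \<Longrightarrow> conv P \<in> \<T> \<Longrightarrow>
    3 simplex (conv P) \<Longrightarrow> \<mu>0 * diameter (conv P) ^ 3 \<le> \<bar>det (tet_matrix P)\<bar>"
    using det_tet_matrix_lower_bound[OF assms(1)] by metis
  \<comment> \<open>Diameters are at most \<open>h / c1\<close>, and the summand 1 makes
    \<open>\<kappa>\<close> at least 1. They are at least \<open>h / c2\<close>, which enters
    \<open>\<mu>\<close> cubed; the extra division by \<open>\<kappa>\<close> pays for the passage
    from volume to panel area.\<close>
  define \<kappa> where "\<kappa> = 1 / c1 + 1"
  define \<mu> where "\<mu> = \<mu>0 / c2 ^ 3 / \<kappa>"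
  have \<kappa>: "1 \<le> \<kappa>"
    using assms by (simp add: \<kappa>_def)
  then have \<mu>: "0 < \<mu>"
    using assms \<mu>0 by (simp add: \<mu>_def)
  have tet: "0 < mesh_size \<T> \<and> diameter (conv P) \<le> \<kappa> * mesh_size \<T> \<and>
       \<mu> * \<kappa> * mesh_size \<T> ^ 3 \<le> \<bar>det (tet_matrix P)\<bar>"
    if T: "regular_partition \<Omega> \<T>" "shape_regular \<theta> \<T>" "quasi_uniform c1 c2 \<T>" and P: "conv P \<in> \<T>"
    for \<Omega> \<T> P
  proof -
    let ?h = "mesh_size \<T>" and ?d = "diameter (conv P)"
    have simplex: "3 simplex (conv P)"
      using T(1) P by (simp add: regular_partition_def)
    have "P$1 \<noteq> P$2"
      using simplex_conv_vertices(2)[OF simplex] by (auto simp: inj_eq)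
    then have d: "0 < ?d"
      using norm_edge_le_diameter[of P 1 2] by (smt (verit) zero_less_norm_iff right_minus_eq)
    note h = mesh_size_bounds[OF T(1,3) P]
    have h0: "0 < ?h"
      using h(1) d assms(2) by (smt (verit) mult_pos_pos)
    have "?d \<le> ?h / c1"
      using h(1) assms(2) by (simp add: field_simps)
    then have "?d \<le> \<kappa> * ?h"
      using h0 by (simp add: \<kappa>_def algebra_simps)
    moreover have "\<mu> * \<kappa> * ?h ^ 3 \<le> \<bar>det (tet_matrix P)\<bar>"
    proof -
      have "\<mu> * \<kappa> * ?h ^ 3 = \<mu>0 * (?h / c2) ^ 3"
        using \<kappa> by (simp add: \<mu>_def power_divide)
      also have "\<dots> \<le> \<mu>0 * ?d ^ 3"
        using h(2) assms(3) h0 \<mu>0 by (intro mult_left_mono power_mono) (auto simp: field_simps)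
      also have "\<dots> \<le> \<bar>det (tet_matrix P)\<bar>"
        by (rule det[OF T(2) P simplex])
      finally show ?thesis .
    qed
    ultimately show ?thesis
      using h0 by blast
  qed
  have panel: "diameter (conv Q) \<le> \<kappa> * mesh_size \<T> \<and>
       \<mu> * (mesh_size \<T>)\<^sup>2 \<le> norm (cross3 (Q$2 - Q$1) (Q$3 - Q$2))"
    if T: "regular_partition \<Omega> \<T>" "shape_regular \<theta> \<T>" "quasi_uniform c1 c2 \<T>" and Q: "conv Q \<in> panels \<T>"
    for \<Omega> \<T> and Q :: "real^3^3"
  proof -
    let ?h = "mesh_size \<T>" and ?X = "norm (cross3 (Q$2 - Q$1) (Q$3 - Q$2))"
    obtain t where t: "t \<in> \<T>" "conv Q facet_of t"
      using Q by (auto simp: panels_def)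
    then have "3 simplex t"
      using T(1) by (simp add: regular_partition_def)
    from panel_conv_vertices(2)[OF this t(2)] obtain P :: "real^3^4"
      where P: "conv P = t" "P$1 = Q$1" "P$2 = Q$2" "P$3 = Q$3" by blast
    note tP = tet[OF T, of P, unfolded P(1), OF t(1)]
    have "diameter (conv Q) \<le> diameter t"
      using facet_of_imp_subset[OF t(2)] compact_imp_bounded[OF compact_conv[of P]]
      by (intro diameter_subset) (auto simp: P(1))
    \<comment> \<open>The determinant is an edge vector paired with the panel's normal, so a lower
      bound on the volume and an upper bound on that edge bound the area from below.\<close>
    moreover have "\<mu> * ?h\<^sup>2 \<le> ?X"
    proof -
      have "det (tet_matrix P) = (P$4 - P$2) \<bullet> cross3 (Q$2 - Q$1) (Q$3 - Q$2)"
        unfolding det_tet_matrix P(2-4) by (simp add: cross3_simps)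
      then have "\<bar>det (tet_matrix P)\<bar> \<le> norm (P$4 - P$2) * ?X"
        by (simp add: Cauchy_Schwarz_ineq2)
      also have "\<dots> \<le> (\<kappa> * ?h) * ?X"
        using norm_edge_le_diameter[of P 4 2] tP by (intro mult_right_mono) (auto simp: P(1))
      finally have "(\<kappa> * ?h) * (\<mu> * ?h\<^sup>2) \<le> (\<kappa> * ?h) * ?X"
        using tP by (simp add: eval_nat_numeral mult_ac)
      then show ?thesis
        using tP \<kappa> by (simp add: mult_le_cancel_left_pos)
    qed
    ultimately show ?thesis
      using tP by linarith
  qed
  have "\<mu> * mesh_size \<T> ^ 3 \<le> \<mu> * \<kappa> * mesh_size \<T> ^ 3" if "0 < mesh_size \<T>" for \<T>
    using that \<mu> \<kappa> by (intro mult_right_mono) auto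
  then show ?thesis
    using \<kappa> \<mu> tet panel by (intro exI[of _ \<kappa>] exI[of _ \<mu>]) (meson order_trans)
qed

section \<open>Shape functions on one tetrahedron\<close>

text \<open>A vertex in \<open>\<Omega>\<close> is an inner node, where the basis function is 0 or
  1; outside \<open>\<Omega>\<close> the function vanishes.\<close>

lemma nodal_basis_affine:
  fixes P :: "real^3^4"
  assumes "regular_partition \<Omega> \<T>" "nodal_basis \<Omega> \<T> N \<phi>" "i \<in> {1..N}" "conv P \<in> \<T>"
  shows "\<exists>a b. (\<forall>x\<in>conv P. \<phi> i x = a \<bullet> x + b)" "\<phi> i (P$k) \<in> {0, 1}"
proof -
  obtain z where z: "bij_betw z {1..N} (inner_nodes \<Omega> \<T>)" "\<phi> i \<in> fe_space \<Omega> \<T>"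
    "\<And>k. k \<in> {1..N} \<Longrightarrow> \<phi> i (z k) = (if k = i then 1 else 0)"
    using assms(2,3) unfolding nodal_basis_def by blast
  show "\<exists>a b. (\<forall>x\<in>conv P. \<phi> i x = a \<bullet> x + b)"
    using z(2) assms(4) by (auto simp: fe_space_def)
  have "P$k extreme_point_of conv P"
    using simplex_conv_vertices(3)[of P] assms(1,4) by (auto simp: regular_partition_def)
  then have "P$k \<in> inner_nodes \<Omega> \<T>" if "P$k \<in> \<Omega>"
    using that assms(4) by (auto simp: inner_nodes_def)
  then have "P$k \<in> z ` {1..N}" if "P$k \<in> \<Omega>"
    using that z(1) by (simp add: bij_betw_def)
  then show "\<phi> i (P$k) \<in> {0, 1}"
    using z(2,3) by (cases "P$k \<in> \<Omega>") (auto simp: fe_space_def)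
qed

text \<open>The definite description is unique because a nondegenerate tetrahedron affinely spans
  the whole space.\<close>

lemma affine_extension_eqI:
  fixes P :: "real^3^4"
  assumes "3 simplex (conv P)" "\<And>x. x \<in> conv P \<Longrightarrow> v x = a \<bullet> x + b"
  shows "affine_extension v (conv P) = (\<lambda>x. a \<bullet> x + b)"
  unfolding affine_extension_def
proof (rule the_equality)
  show "(\<exists>a' b'. (\<lambda>x. a \<bullet> x + b) = (\<lambda>x. a' \<bullet> x + b')) \<and> (\<forall>x\<in>conv P. a \<bullet> x + b = v x)"
    using assms(2) by auto
next
  fix l assume "(\<exists>a b. l = (\<lambda>x. a \<bullet> x + b)) \<and> (\<forall>x\<in>conv P. l x = v x)"
  then obtain a' b' where l: "l = (\<lambda>x. a' \<bullet> x + b')" "\<forall>x\<in>conv P. l x = v x"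
    by blast
  have "conv P \<subseteq> {x. (a - a') \<bullet> x = b' - b}"
    using l assms(2) by (auto simp: inner_diff_left algebra_simps)
  then have "affine hull (conv P) \<subseteq> {x. (a - a') \<bullet> x = b' - b}"
    by (intro hull_minimal affine_hyperplane)
  moreover have "affine hull (conv P) = UNIV"
  proof -
    obtain C where "\<not> affine_dependent C" "int (card C) = 3 + 1" "conv P = convex hull C"
      using assms(1) by (auto simp: simplex_def)
    then have "aff_dim (conv P) = 3"
      using aff_dim_affine_independent[of C] by (simp add: aff_dim_convex_hull)
    then show ?thesis
      using aff_dim_eq_full[of "conv P"] by simp
  qed
  ultimately have "(a - a') \<bullet> x = b' - b" for x
    by blast
  then show "l = (\<lambda>x. a \<bullet> x + b)"
    unfolding l(1) by (intro ext) (simp add: inner_diff_left algebra_simps)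
qed

lemma bounded_affine_at_nodal_basis:
  assumes "regular_partition \<Omega> \<T>" "nodal_basis \<Omega> \<T> N \<phi>" "i \<in> {1..N}" "conv P \<in> \<T>"
  shows "bounded_affine_at (affine_extension (\<phi> i) (conv P)) P X"
    and "tet_map P ` X \<subseteq> conv P \<Longrightarrow> bounded_affine_at (\<phi> i) P X"
proof -
  obtain a b where ab: "\<And>x. x \<in> conv P \<Longrightarrow> \<phi> i x = a \<bullet> x + b"
    using nodal_basis_affine(1)[OF assms] by blast
  have simplex: "3 simplex (conv P)"
    using assms(1,4) by (simp add: regular_partition_def)
  have ext: "affine_extension (\<phi> i) (conv P) = (\<lambda>x. a \<bullet> x + b)"
    by (rule affine_extension_eqI[OF simplex ab])
  have nodes: "a \<bullet> (P$k) + b \<in> {0, 1}" for k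
    using nodal_basis_affine(2)[OF assms, of k] ab[OF vertex_in_conv[of P k]] by simp
  \<comment> \<open>The slopes in reference coordinates are differences of vertex values, each of
    which is 0 or 1.\<close>
  define l :: "real^3" where "l = vector [a \<bullet> (P$2 - P$1), a \<bullet> (P$3 - P$2), a \<bullet> (P$4 - P$2)]"
  have "\<bar>l$1\<bar> \<le> 2 \<and> \<bar>l$2\<bar> \<le> 2 \<and> \<bar>l$3\<bar> \<le> 2"
    using nodes[of 1] nodes[of 2] nodes[of 3] nodes[of 4] by (auto simp: l_def inner_diff_right)
  then have l: "\<bar>l$k\<bar> \<le> 2" for k
    using exhaust_3[of k] by auto
  have c: "\<bar>a \<bullet> (P$1) + b\<bar> \<le> 1"
    using nodes[of 1] by auto
  have eq: "a \<bullet> tet_map P x + b = (a \<bullet> (P$1) + b) + l \<bullet> x" for x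
    by (simp add: tet_map_eq l_def inner_vec_def[of _ x] sum_3 inner_add_right mult_ac)
  show "bounded_affine_at (affine_extension (\<phi> i) (conv P)) P X"
    unfolding bounded_affine_at_def ext using c l eq by blast
  show "bounded_affine_at (\<phi> i) P X" if "tet_map P ` X \<subseteq> conv P"
  proof -
    have "\<phi> i (tet_map P x) = (a \<bullet> (P$1) + b) + l \<bullet> x" if "x \<in> X" for x
      using ab[of "tet_map P x"] \<open>tet_map P ` X \<subseteq> conv P\<close> that eq by auto
    then show ?thesis
      unfolding bounded_affine_at_def using c l by blast
  qed
qed

section \<open>Lower bounds for the distance\<close>

text \<open>Cramer's rule: pairing \<open>z\<close> with the cross product of two basis vectors
  isolates the third coordinate.\<close>

lemma triple_coordinates:
  fixes e1 e2 e3 :: "real^3"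
  assumes "norm e1 \<le> K" "norm e2 \<le> K" "norm e3 \<le> K" "z = t1 *\<^sub>R e1 + t2 *\<^sub>R e2 + t3 *\<^sub>R e3"
  shows "\<bar>t1\<bar> * \<bar>e1 \<bullet> cross3 e2 e3\<bar> \<le> norm z * K\<^sup>2"
    and "\<bar>t2\<bar> * \<bar>e1 \<bullet> cross3 e2 e3\<bar> \<le> norm z * K\<^sup>2"
    and "\<bar>t3\<bar> * \<bar>e1 \<bullet> cross3 e2 e3\<bar> \<le> norm z * K\<^sup>2"
proof -
  have K: "0 \<le> K"
    using assms(1) norm_ge_zero order_trans by blast
  have le: "\<bar>z \<bullet> cross3 u v\<bar> \<le> norm z * K\<^sup>2" if "norm u \<le> K" "norm v \<le> K" for u v
    using that K unfolding power2_eq_square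
    by (intro order_trans[OF abs_triple_le] mult_mono) auto
  have "z \<bullet> cross3 e2 e3 = t1 * (e1 \<bullet> cross3 e2 e3)"
    "z \<bullet> cross3 e3 e1 = t2 * (e1 \<bullet> cross3 e2 e3)"
    "z \<bullet> cross3 e1 e2 = t3 * (e1 \<bullet> cross3 e2 e3)"
    unfolding assms(4) by (simp_all add: cross3_simps)
  then show "\<bar>t1\<bar> * \<bar>e1 \<bullet> cross3 e2 e3\<bar> \<le> norm z * K\<^sup>2"
    "\<bar>t2\<bar> * \<bar>e1 \<bullet> cross3 e2 e3\<bar> \<le> norm z * K\<^sup>2"
    "\<bar>t3\<bar> * \<bar>e1 \<bullet> cross3 e2 e3\<bar> \<le> norm z * K\<^sup>2"
    using le[OF assms(2,3)] le[OF assms(3,1)] le[OF assms(1,2)] by (simp_all add: abs_mult)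
qed

lemma pair_coordinates:
  fixes e1 e2 :: "real^3"
  assumes "norm e1 \<le> K" "norm e2 \<le> K" "z = t1 *\<^sub>R e1 + t2 *\<^sub>R e2"
  shows "\<bar>t1\<bar> * norm (cross3 e1 e2) \<le> norm z * K" "\<bar>t2\<bar> * norm (cross3 e1 e2) \<le> norm z * K"
proof -
  have "t1 *\<^sub>R cross3 e1 e2 = cross3 z e2" "t2 *\<^sub>R cross3 e1 e2 = cross3 e1 z"
    unfolding assms(3) by (simp_all add: cross3_simps)
  then have "\<bar>t1\<bar> * norm (cross3 e1 e2) = norm (cross3 z e2)"
    "\<bar>t2\<bar> * norm (cross3 e1 e2) = norm (cross3 e1 z)"
    by (metis norm_scaleR)+
  then show "\<bar>t1\<bar> * norm (cross3 e1 e2) \<le> norm z * K" "\<bar>t2\<bar> * norm (cross3 e1 e2) \<le> norm z * K"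
    using order_trans[OF norm_cross3_le mult_left_mono[OF assms(2)], of z]
      order_trans[OF norm_cross3_le mult_right_mono[OF assms(1)], of z]
    by (simp_all add: mult.commute)
qed

lemma tet_map_in_conv:
  assumes "x$1 \<le> 1" "0 \<le> x$2" "0 \<le> x$3" "x$2 + x$3 \<le> x$1"
  shows "tet_map P x \<in> conv P"
proof -
  \<comment> \<open>The barycentric coordinates of the image point.\<close>
  define u :: "4 \<Rightarrow> real" where
    "u k = (if k = 1 then 1 - x$1 else if k = 2 then x$1 - x$2 - x$3 else if k = 3 then x$2 else x$3)" for k
  have "(\<Sum>k\<in>UNIV. u k *\<^sub>R P$k) \<in> conv P"
    unfolding conv_def
  proof (rule convex_sum)
    show "0 \<le> u k" for k
      using assms by (simp add: u_def)
  qed (auto simp: u_def sum_4 intro: hull_inc)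
  also have "(\<Sum>k\<in>UNIV. u k *\<^sub>R P$k) = tet_map P x"
    by (simp add: u_def sum_4 tet_map_eq algebra_simps)
  finally show ?thesis .
qed

lemma tri_map_in_conv:
  assumes "y$1 \<le> 1" "0 \<le> y$2" "y$2 \<le> y$1"
  shows "tri_map Q y \<in> conv Q"
proof -
  define u :: "3 \<Rightarrow> real" where
    "u k = (if k = 1 then 1 - y$1 else if k = 2 then y$1 - y$2 else y$2)" for k
  have "(\<Sum>k\<in>UNIV. u k *\<^sub>R Q$k) \<in> conv Q"
    unfolding conv_def
  proof (rule convex_sum)
    show "0 \<le> u k" for k
      using assms by (simp add: u_def)
  qed (auto simp: u_def sum_3 intro: hull_inc)
  also have "(\<Sum>k\<in>UNIV. u k *\<^sub>R Q$k) = tri_map Q y"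
    by (simp add: u_def sum_3 tri_map_eq algebra_simps)
  finally show ?thesis .
qed

text \<open>\<open>\<beta> h\<close> bounds the heights of both elements from below.\<close>

definition nondegenerate_pair :: "real \<Rightarrow> real \<Rightarrow> real \<Rightarrow> real^3^4 \<Rightarrow> real^3^3 \<Rightarrow> bool" where
  "nondegenerate_pair \<kappa> \<beta> h P Q \<longleftrightarrow> 0 < h \<and> scaled_pair \<kappa> h P Q \<and>
     (\<forall>x i. \<beta> * h * \<bar>x$i\<bar> \<le> norm (tet_map P x - P$1)) \<and>
     (\<forall>y i. \<beta> * h * \<bar>y$i\<bar> \<le> norm (tri_map Q y - Q$1))"

text \<open>Cramer's rule divides the determinant by two edge lengths, hence
  \<open>\<kappa>^2\<close>. For the panel a single \<open>\<kappa>\<close> would appear, and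
  \<open>1 \<le> \<kappa>\<close> allows the same constant.\<close>

lemma nondegenerate_pairI:
  assumes "0 < h" "scaled_pair \<kappa> h P Q" "1 \<le> \<kappa>" "0 < \<mu>"
    and "\<mu> * h ^ 3 \<le> \<bar>det (tet_matrix P)\<bar>" "\<mu> * h\<^sup>2 \<le> norm (cross3 (Q$2 - Q$1) (Q$3 - Q$2))"
  shows "nondegenerate_pair \<kappa> (\<mu> / \<kappa>\<^sup>2) h P Q"
proof -
  note edges = assms(2)[unfolded scaled_pair_def]
  have "\<mu> / \<kappa>\<^sup>2 * h * \<bar>x$i\<bar> \<le> norm (tet_map P x - P$1)" for x i
  proof -
    let ?z = "tet_map P x - P$1"
    have "\<bar>x$i\<bar> * \<bar>det (tet_matrix P)\<bar> \<le> norm ?z * (\<kappa> * h)\<^sup>2"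
      unfolding det_tet_matrix
      using exhaust_3[of i] edges
        triple_coordinates[of "P$2 - P$1" "\<kappa> * h" "P$3 - P$2" "P$4 - P$2" ?z "x$1" "x$2" "x$3"]
      by (auto simp: tet_map_eq)
    then have "\<bar>x$i\<bar> * (\<mu> * h ^ 3) \<le> norm ?z * (\<kappa> * h)\<^sup>2"
      using mult_left_mono[OF assms(5), of "\<bar>x$i\<bar>"] by linarith
    then have "(\<bar>x$i\<bar> * (\<mu> * h)) * h\<^sup>2 \<le> (norm ?z * \<kappa>\<^sup>2) * h\<^sup>2"
      by (simp add: eval_nat_numeral mult_ac)
    then have "\<bar>x$i\<bar> * (\<mu> * h) \<le> norm ?z * \<kappa>\<^sup>2"
      using assms(1) by (simp add: mult_le_cancel_right)
    then show ?thesis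
      using assms(3) by (simp add: divide_le_eq mult_ac)
  qed
  moreover have "\<mu> / \<kappa>\<^sup>2 * h * \<bar>y$i\<bar> \<le> norm (tri_map Q y - Q$1)" for y i
  proof -
    let ?z = "tri_map Q y - Q$1"
    have "\<bar>y$i\<bar> * norm (cross3 (Q$2 - Q$1) (Q$3 - Q$2)) \<le> norm ?z * (\<kappa> * h)"
      using exhaust_2[of i] edges
        pair_coordinates[of "Q$2 - Q$1" "\<kappa> * h" "Q$3 - Q$2" ?z "y$1" "y$2"]
      by (auto simp: tri_map_eq)
    then have "\<bar>y$i\<bar> * (\<mu> * h\<^sup>2) \<le> norm ?z * (\<kappa> * h)"
      using mult_left_mono[OF assms(6), of "\<bar>y$i\<bar>"] by linarith
    then have "(\<bar>y$i\<bar> * (\<mu> * h)) * h \<le> (norm ?z * \<kappa>) * h"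
      by (simp add: eval_nat_numeral mult_ac)
    then have "\<bar>y$i\<bar> * (\<mu> * h) \<le> norm ?z * \<kappa>"
      using assms(1) by (simp add: mult_le_cancel_right)
    also have "\<dots> \<le> norm ?z * \<kappa>\<^sup>2"
      using assms(3) by (intro mult_left_mono) (auto simp: power2_eq_square)
    finally show ?thesis
      using assms(3) by (simp add: divide_le_eq mult_ac)
  qed
  ultimately show ?thesis
    using assms(1,2) by (simp add: nondegenerate_pair_def)
qed

text \<open>A first coordinate equal to 1 puts the point on the side opposite to the common vertex,
  at least a height away from it; the geometric assumption passes this on to the distance of the two
  points.\<close>

lemma vertex_distance_bound:
  assumes "nondegenerate_pair \<kappa> \<beta> h P Q" "0 < cA" "P$1 = Q$1"
    and dist: "\<And>x y. x \<in> conv P \<Longrightarrow> y \<in> conv Q \<Longrightarrow> cA * (dist x (P$1) + dist (P$1) y) \<le> dist x y"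
    and x: "x$1 \<le> 1" "0 \<le> x$2" "0 \<le> x$3" "x$2 + x$3 \<le> x$1"
    and y: "y$1 \<le> 1" "0 \<le> y$2" "y$2 \<le> y$1"
    and "x$1 = 1 \<or> y$1 = 1"
  shows "cA * \<beta> * h \<le> norm (tri_map Q y - tet_map P x)"
proof -
  have "\<beta> * h * \<bar>x$1\<bar> \<le> norm (tet_map P x - P$1)" "\<beta> * h * \<bar>y$1\<bar> \<le> norm (tri_map Q y - Q$1)"
    using assms(1) by (auto simp: nondegenerate_pair_def)
  then have "\<beta> * h \<le> dist (tet_map P x) (P$1) + dist (P$1) (tri_map Q y)"
    using assms(3,12) by (auto simp: dist_norm norm_minus_commute add_increasing add_increasing2)
  then have "cA * (\<beta> * h) \<le> dist (tet_map P x) (tri_map Q y)"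
    using dist[OF tet_map_in_conv[OF x] tri_map_in_conv[OF y]] assms(2)
      mult_left_mono[of "\<beta> * h" _ cA] by (meson less_imp_le order_trans)
  then show ?thesis
    by (simp add: dist_norm norm_minus_commute mult.assoc)
qed

text \<open>Only the difference of the points matters, so both may be shifted along the common edge into
  the elements. The geometric assumption then controls the components transversal to the edge, and
  they in turn control the component along the edge.\<close>

lemma edge_distance_bound:
  assumes nd: "nondegenerate_pair \<kappa> \<beta> h P Q" and "0 < \<beta>" "0 < \<kappa>" "0 < cA"
    and PQ: "P$1 = Q$1" "P$2 = Q$2"
    and dist: "\<And>x y. x \<in> conv P \<Longrightarrow> y \<in> conv Q \<Longrightarrow>
      \<exists>p\<in>closed_segment (P$1) (P$2). cA * (dist x p + dist p y) \<le> dist x y"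
    and x: "x$1 \<le> 0" "0 \<le> x$2" "0 \<le> x$3" "x$2 + x$3 \<le> 1 + x$1"
    and y: "y$1 \<le> 0" "0 \<le> y$2" "y$2 \<le> 1 + y$1"
    and one: "1 \<le> \<bar>x$1 - y$1\<bar> + x$2 + x$3 + y$2"
  shows "1 / (1 / \<beta> + 3 * \<kappa> / (cA * \<beta>\<^sup>2) + 3 / (cA * \<beta>)) * h \<le> norm (tri_map Q y - tet_map P x)"
proof -
  define w where "w = norm (tri_map Q y - tet_map P x)"
  define r where "r = w / (cA * \<beta>)"
  have h: "0 < h" and tetc: "\<And>x i. \<beta> * h * \<bar>x$i\<bar> \<le> norm (tet_map P x - P$1)"
    and tric: "\<And>y i. \<beta> * h * \<bar>y$i\<bar> \<le> norm (tri_map Q y - Q$1)"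
    and sp: "scaled_pair \<kappa> h P Q"
    using nd by (auto simp: nondegenerate_pair_def)
  define e where "e = P$2 - P$1"
  \<comment> \<open>Adding 1 to the first coordinate translates both points by the common edge
    \<open>e\<close>, which brings them into their elements.\<close>
  define x' where "x' = x + axis 1 1"
  define y' where "y' = y + axis 1 1"
  have x': "x'$1 = x$1 + 1" "x'$2 = x$2" "x'$3 = x$3" and y': "y'$1 = y$1 + 1" "y'$2 = y$2"
    by (auto simp: x'_def y'_def axis_def)
  have X': "tet_map P x' = tet_map P x + e" and Y': "tri_map Q y' = tri_map Q y + e"
    using PQ by (auto simp: tet_map_eq tri_map_eq x' y' e_def algebra_simps)
  have "tet_map P x' \<in> conv P"
    using x by (intro tet_map_in_conv) (auto simp: x')
  moreover have "tri_map Q y' \<in> conv Q"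
    using y by (intro tri_map_in_conv) (auto simp: y')
  ultimately obtain p where p: "p \<in> closed_segment (P$1) (P$2)"
    "cA * (dist (tet_map P x') p + dist p (tri_map Q y')) \<le> dist (tet_map P x') (tri_map Q y')"
    using dist by blast
  obtain u where u: "p = P$1 + u *\<^sub>R e"
    using p(1) by (auto simp: in_segment e_def algebra_simps)
  have dw: "dist (tet_map P x') (tri_map Q y') = w"
    by (simp add: w_def X' Y' dist_norm norm_minus_commute)
  \<comment> \<open>Coordinates with \<open>p\<close> as origin; the transversal ones are unchanged,
    so the height bounds apply to the distances from \<open>p\<close>.\<close>
  define x'' where "x'' = x' - axis 1 u"
  define y'' where "y'' = y' - axis 1 u"
  have x'': "x''$1 = x'$1 - u" "x''$2 = x$2" "x''$3 = x$3" and y'': "y''$1 = y'$1 - u" "y''$2 = y$2"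
    by (auto simp: x''_def y''_def axis_def x' y')
  have "tet_map P x'' - P$1 = tet_map P x' - p" "tri_map Q y'' - Q$1 = tri_map Q y' - p"
    using PQ by (auto simp: tet_map_eq tri_map_eq x'' y'' x' y' u e_def algebra_simps)
  then have "\<beta> * h * \<bar>x$2\<bar> \<le> dist (tet_map P x') p" "\<beta> * h * \<bar>x$3\<bar> \<le> dist (tet_map P x') p"
    "\<beta> * h * \<bar>y$2\<bar> \<le> dist p (tri_map Q y')"
    using tetc[where x=x'' and i=2] tetc[where x=x'' and i=3] tric[where y=y'' and i=2]
    by (simp_all add: x'' y'' dist_norm norm_minus_commute)
  moreover have "dist (tet_map P x') p + dist p (tri_map Q y') \<le> w / cA"
    using p(2) dw assms(4) by (simp add: field_simps)
  ultimately have "\<beta> * h * \<bar>x$2\<bar> \<le> w / cA" "\<beta> * h * \<bar>x$3\<bar> \<le> w / cA" "\<beta> * h * \<bar>y$2\<bar> \<le> w / cA"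
    using zero_le_dist[of p "tri_map Q y'"] zero_le_dist[of "tet_map P x'" p] by linarith+
  then have comp: "h * x$2 \<le> r" "h * x$3 \<le> r" "h * y$2 \<le> r"
    using assms(2,4) x y by (auto simp: r_def field_simps)
  have edges: "norm (P$3 - P$2) \<le> \<kappa> * h" "norm (P$4 - P$2) \<le> \<kappa> * h" "norm (Q$3 - Q$2) \<le> \<kappa> * h"
    using sp by (auto simp: scaled_pair_def)
  \<comment> \<open>Removing the transversal parts from the difference of the points leaves the part
    along the edge.\<close>
  have "(x$1 - y$1) *\<^sub>R e = (tet_map P x - tri_map Q y) +
      (y$2 *\<^sub>R (Q$3 - Q$2) - (x$2 *\<^sub>R (P$3 - P$2) + x$3 *\<^sub>R (P$4 - P$2)))"
    using PQ by (simp add: tet_map_eq tri_map_eq e_def algebra_simps)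
  then have "norm ((x$1 - y$1) *\<^sub>R e) \<le> norm (tet_map P x - tri_map Q y) +
      (norm (y$2 *\<^sub>R (Q$3 - Q$2)) + (norm (x$2 *\<^sub>R (P$3 - P$2)) + norm (x$3 *\<^sub>R (P$4 - P$2))))"
    by (metis norm_triangle_le norm_triangle_le_diff norm_triangle_ineq add_left_mono order_refl)
  also have "\<dots> \<le> w + (\<kappa> * r + (\<kappa> * r + \<kappa> * r))"
  proof (intro add_mono)
    have "t * norm v \<le> \<kappa> * r" if "norm v \<le> \<kappa> * h" "h * t \<le> r" "0 \<le> t" for t and v :: "real^3"
    proof -
      have "t * norm v \<le> t * (\<kappa> * h)"
        using that by (intro mult_left_mono) auto
      also have "\<dots> = \<kappa> * (h * t)" by simp
      also have "\<dots> \<le> \<kappa> * r"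
        using that assms(3) by (intro mult_left_mono) auto
      finally show ?thesis .
    qed
    then show "norm (y$2 *\<^sub>R (Q$3 - Q$2)) \<le> \<kappa> * r" "norm (x$2 *\<^sub>R (P$3 - P$2)) \<le> \<kappa> * r"
      "norm (x$3 *\<^sub>R (P$4 - P$2)) \<le> \<kappa> * r"
      using edges comp x y by simp_all
  qed (simp add: w_def norm_minus_commute)
  finally have "\<bar>x$1 - y$1\<bar> * norm e \<le> w + 3 * \<kappa> * r" by simp
  moreover have "\<beta> * h \<le> norm e"
    using tetc[of "axis 1 1" 1] by (simp add: tet_map_eq axis_def e_def)
  ultimately have "\<bar>x$1 - y$1\<bar> * (\<beta> * h) \<le> w + 3 * \<kappa> * r"
    using mult_left_mono[of "\<beta> * h" "norm e" "\<bar>x$1 - y$1\<bar>"] by linarith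
  then have "h * \<bar>x$1 - y$1\<bar> \<le> (w + 3 * \<kappa> * r) / \<beta>"
    using assms(2) by (simp add: field_simps)
  moreover have "h * 1 \<le> h * (\<bar>x$1 - y$1\<bar> + x$2 + x$3 + y$2)"
    using one h by (intro mult_left_mono) auto
  ultimately have "h \<le> (w + 3 * \<kappa> * r) / \<beta> + 3 * r"
    using comp by (simp add: distrib_left)
  \<comment> \<open>The three summands come from \<open>w\<close> itself, from the transversal parts
    removed above, and from the three transversal coordinates in \<open>one\<close>.\<close>
  also have "\<dots> = (1 / \<beta> + 3 * \<kappa> / (cA * \<beta>\<^sup>2) + 3 / (cA * \<beta>)) * w"
    using assms(2,4) by (simp add: r_def field_simps power2_eq_square)
  finally have le: "h \<le> (1 / \<beta> + 3 * \<kappa> / (cA * \<beta>\<^sup>2) + 3 / (cA * \<beta>)) * w" .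
  have "0 < 1 / \<beta> + 3 * \<kappa> / (cA * \<beta>\<^sup>2) + 3 / (cA * \<beta>)"
    using assms(2-4) by (intro add_pos_pos) auto
  then show ?thesis
    using le unfolding w_def by (simp add: divide_le_eq mult.commute)
qed

text \<open>The differences of the relative coordinates are the coordinates of a single vector in the edge
  basis of the tetrahedron, so that Cramer's rule suffices.\<close>

lemma face_distance_bound:
  assumes nd: "nondegenerate_pair \<kappa> \<beta> h P Q" and "0 < \<beta>"
    and PQ: "P$1 = Q$1" "P$2 = Q$2" "P$3 = Q$3"
    and one: "1 \<le> \<bar>x$1 - y$1\<bar> + \<bar>x$2 - y$2\<bar> + \<bar>x$3\<bar>"
  shows "\<beta> / 3 * h \<le> norm (tri_map Q y - tet_map P x)"
proof -
  define z :: "real^3" where "z = vector [x$1 - y$1, x$2 - y$2, x$3]"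
  have z: "z$1 = x$1 - y$1" "z$2 = x$2 - y$2" "z$3 = x$3"
    by (auto simp: z_def)
  have "tet_map P z - P$1 = tet_map P x - tri_map Q y"
    using PQ by (simp add: tet_map_eq tri_map_eq z algebra_simps)
  then have "\<beta> * h * \<bar>z$i\<bar> \<le> norm (tri_map Q y - tet_map P x)" for i
    using nd by (metis nondegenerate_pair_def norm_minus_commute)
  from this[of 1] this[of 2] this[of 3]
  have "\<beta> * h * (\<bar>x$1 - y$1\<bar> + \<bar>x$2 - y$2\<bar> + \<bar>x$3\<bar>) \<le> 3 * norm (tri_map Q y - tet_map P x)"
    by (simp add: z distrib_left)
  moreover have "\<beta> * h * 1 \<le> \<beta> * h * (\<bar>x$1 - y$1\<bar> + \<bar>x$2 - y$2\<bar> + \<bar>x$3\<bar>)"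
    using one assms(2) nd by (intro mult_left_mono) (auto simp: nondegenerate_pair_def)
  ultimately show ?thesis by linarith
qed

section \<open>Convergence of the quadrature\<close>

text \<open>Values in \<open>[0, 1]\<close> make the class closed under products and under
  \<open>1 - p\<close>, from which the coordinates are built; signs are added only on passing to
  \<open>unit_poly\<close>.\<close>

definition cube_poly :: "nat \<Rightarrow> (real^'k \<Rightarrow> real) \<Rightarrow> bool" where
  "cube_poly d p \<longleftrightarrow> coord_poly d p \<and> (\<forall>\<eta>\<in>cbox 0 1. 0 \<le> p \<eta> \<and> p \<eta> \<le> 1)"

lemma cube_poly_coord: "cube_poly 1 (\<lambda>\<eta>. \<eta> $ i)"
  by (auto simp: cube_poly_def mem_box_cart intro: coord_poly_coord)

lemma cube_poly_mult: "cube_poly d p \<Longrightarrow> cube_poly d' q \<Longrightarrow> cube_poly (d + d') (\<lambda>\<eta>. p \<eta> * q \<eta>)"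
  by (auto simp: cube_poly_def intro: coord_poly_mult mult_le_one)

lemma cube_poly_compl: "cube_poly d p \<Longrightarrow> cube_poly d (\<lambda>\<eta>. 1 - p \<eta>)"
  by (auto simp: cube_poly_def intro: coord_poly_diff coord_poly_const)

lemma cube_poly_power2: "cube_poly d p \<Longrightarrow> cube_poly (d + d) (\<lambda>\<eta>. (p \<eta>)\<^sup>2)"
  unfolding power2_eq_square by (rule cube_poly_mult)

lemma unit_poly_const: "\<bar>c\<bar> \<le> 1 \<Longrightarrow> unit_poly (\<lambda>\<eta>. c)"
  by (simp add: unit_poly_def coord_poly_const)

lemma unit_poly_cube_poly: "cube_poly d p \<Longrightarrow> d \<le> 4 \<Longrightarrow> unit_poly p"
  by (auto simp: cube_poly_def unit_poly_def intro: coord_poly_mono)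

lemma unit_poly_minus_cube_poly: "cube_poly d p \<Longrightarrow> d \<le> 4 \<Longrightarrow> unit_poly (\<lambda>\<eta>. - p \<eta>)"
  by (auto simp: cube_poly_def unit_poly_def intro: coord_poly_mono coord_poly_uminus)

lemmas cube_poly_intros = cube_poly_power2 cube_poly_coord cube_poly_compl cube_poly_mult

lemma cube_coord:
  assumes "\<eta> \<in> cbox 0 (1 :: real^'k)"
  shows "0 \<le> \<eta> $ i" "\<eta> $ i \<le> 1"
  using assms by (auto simp: mem_box_cart)

definition mesh_configuration :: "real \<Rightarrow> real \<Rightarrow> real \<Rightarrow> real \<Rightarrow> real \<Rightarrow> real \<Rightarrow> interaction \<Rightarrow>
    (real^3) set \<Rightarrow> (real^3) set set \<Rightarrow> nat \<Rightarrow> (nat \<Rightarrow> real^3 \<Rightarrow> real) \<Rightarrow> nat \<Rightarrow> nat \<Rightarrow>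
    real^3^4 \<Rightarrow> real^3^3 \<Rightarrow> real^3 \<Rightarrow> bool" where
  "mesh_configuration \<theta> c1 c2 c3 c4 cA star \<Omega> \<T> N \<phi> i j P Q \<nu> \<longleftrightarrow>
     regular_partition \<Omega> \<T> \<and> shape_regular \<theta> \<T> \<and> quasi_uniform c1 c2 \<T> \<and>
     geometric_assumption cA \<T> \<and> nodal_basis \<Omega> \<T> N \<phi> \<and> i \<in> {1..N} \<and> j \<in> {1..N} \<and>
     conv P \<in> \<T> \<and> conv Q \<in> panels \<T> \<and> unit_normal (conv Q) \<nu> \<and>
     configuration star c3 c4 (mesh_size \<T>) P Q"

lemma mesh_nondegenerate_pair:
  assumes "0 < \<theta>" "0 < c1" "0 < c2" "0 < c4"
  obtains \<kappa> \<beta> where "0 < \<kappa>" "0 < \<beta>"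
    "\<And>c3 cA star \<Omega> \<T> N \<phi> i j P Q \<nu>. mesh_configuration \<theta> c1 c2 c3 c4 cA star \<Omega> \<T> N \<phi> i j P Q \<nu> \<Longrightarrow>
       nondegenerate_pair \<kappa> \<beta> (mesh_size \<T>) P Q"
proof -
  obtain \<kappa> \<mu> where \<kappa>: "1 \<le> \<kappa>" and \<mu>: "0 < \<mu>"
    and scal: "\<And>\<Omega> \<T>. regular_partition \<Omega> \<T> \<and> shape_regular \<theta> \<T> \<and> quasi_uniform c1 c2 \<T> \<Longrightarrow>
    (\<forall>P. conv P \<in> \<T> \<longrightarrow> 0 < mesh_size \<T> \<and> diameter (conv P) \<le> \<kappa> * mesh_size \<T> \<and>
       \<mu> * mesh_size \<T> ^ 3 \<le> \<bar>det (tet_matrix P)\<bar>) \<and>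
    (\<forall>Q :: real^3^3. conv Q \<in> panels \<T> \<longrightarrow> diameter (conv Q) \<le> \<kappa> * mesh_size \<T> \<and>
       \<mu> * (mesh_size \<T>)\<^sup>2 \<le> norm (cross3 (Q$2 - Q$1) (Q$3 - Q$2)))"
    using mesh_scaling[OF assms(1-3)] by (elim exE conjE) blast
  \<comment> \<open>In the distant case the first vertices are separated by at most two diameters
    plus the distance of the elements.\<close>
  define \<kappa>' where "\<kappa>' = 2 * \<kappa> + c4"
  have \<kappa>': "1 \<le> \<kappa>'" "\<kappa> \<le> \<kappa>'"
    using \<kappa> assms(4) by (auto simp: \<kappa>'_def)
  have "nondegenerate_pair \<kappa>' (\<mu> / \<kappa>'\<^sup>2) (mesh_size \<T>) P Q"
    if "mesh_configuration \<theta> c1 c2 c3 c4 cA star \<Omega> \<T> N \<phi> i j P Q \<nu>"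
    for c3 cA star \<Omega> \<T> N \<phi> i j P Q \<nu>
  proof -
    let ?h = "mesh_size \<T>"
    note mc = that[unfolded mesh_configuration_def]
    have P: "0 < ?h" "diameter (conv P) \<le> \<kappa> * ?h" "\<mu> * ?h ^ 3 \<le> \<bar>det (tet_matrix P)\<bar>"
      and Q: "diameter (conv Q) \<le> \<kappa> * ?h" "\<mu> * ?h\<^sup>2 \<le> norm (cross3 (Q$2 - Q$1) (Q$3 - Q$2))"
      using scal[of \<Omega> \<T>] mc by auto
    have \<kappa>h: "\<kappa> * ?h \<le> \<kappa>' * ?h"
      using P(1) \<kappa>' by (intro mult_right_mono) auto
    have "norm (P$k - P$l) \<le> \<kappa>' * ?h" "norm (Q$k' - Q$l') \<le> \<kappa>' * ?h" for k l k' l'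
      using norm_edge_le_diameter[of P k l] norm_edge_le_diameter[of Q k' l'] P(2) Q(1) \<kappa>h by linarith+
    moreover have "norm (Q$1 - P$1) \<le> \<kappa>' * ?h"
    proof (cases star)
      case Distant
      have ne: "conv P \<noteq> {}" "conv Q \<noteq> {}"
        using vertex_in_conv[of P 1] vertex_in_conv[of Q 1] by auto
      obtain x y where xy: "x \<in> conv P" "y \<in> conv Q" "dist x y = setdist (conv P) (conv Q)"
        using setdist_compact_closed[OF compact_conv compact_imp_closed[OF compact_conv] ne] by metis
      have "dist (Q$1) (P$1) \<le> dist (Q$1) y + dist y x + dist x (P$1)"
        using dist_triangle[of "Q$1" "P$1" x] dist_triangle[of "Q$1" x y] by linarith
      also have "dist (Q$1) y \<le> diameter (conv Q)"
        by (intro diameter_bounded_bound compact_imp_bounded compact_conv vertex_in_conv xy)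
      also have "dist x (P$1) \<le> diameter (conv P)"
        by (intro diameter_bounded_bound compact_imp_bounded compact_conv vertex_in_conv xy)
      also have "dist y x \<le> c4 * ?h"
        using mc Distant xy(3) by (simp add: dist_commute)
      finally show ?thesis
        using P(2) Q(1) by (simp add: dist_norm \<kappa>'_def algebra_simps)
    next
      case Vertex
      then have "P$1 = Q$1" using mc by auto
      then show ?thesis using P(1) \<kappa>' by simp
    next
      case Edge
      then have "P$1 = Q$1" using mc by auto
      then show ?thesis using P(1) \<kappa>' by simp
    next
      case Face
      then have "P$1 = Q$1" using mc by auto
      then show ?thesis using P(1) \<kappa>' by simp
    qed
    ultimately have "scaled_pair \<kappa>' ?h P Q"
      by (simp add: scaled_pair_def)
    then show ?thesis
      by (intro nondegenerate_pairI P Q \<kappa>' \<mu>)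
  qed
  moreover have "0 < \<kappa>'" "0 < \<mu> / \<kappa>'\<^sup>2"
    using \<kappa>' \<mu> by auto
  ultimately show thesis
    using that by blast
qed

lemma mesh_configuration_kernel:
  assumes "mesh_configuration \<theta> c1 c2 c3 c4 cA star \<Omega> \<T> N \<phi> i j P Q \<nu>"
  shows "norm \<nu> = 1"
    and "bounded_affine_at (affine_extension (\<phi> i) (conv P)) P X"
    and "bounded_affine_at (affine_extension (\<phi> j) (conv P)) P X"
    and "tet_map P ` X \<subseteq> conv P \<Longrightarrow> bounded_affine_at (\<phi> i) P X"
    and "tet_map P ` X \<subseteq> conv P \<Longrightarrow> bounded_affine_at (\<phi> j) P X"
  using assms unfolding mesh_configuration_def
  by (auto simp: unit_normal_def intro: bounded_affine_at_nodal_basis)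

lemma nondegenerate_pairD:
  assumes "nondegenerate_pair \<kappa> \<beta> h P Q"
  shows "0 < h" "scaled_pair \<kappa> h P Q"
  using assms by (auto simp: nondegenerate_pair_def)

section \<open>Exponential convergence in each of the four cases\<close>

text \<open>Both points stay in their elements, so the nodal functions agree with affine ones along
  the way and \<open>c3 * h\<close> bounds the distance directly.\<close>

lemma distant_error:
  assumes "0 < \<theta>" "0 < c1" "0 < c2" "0 < c3" "0 < c4"
  shows "\<exists>C q. 0 < C \<and> 0 < q \<and> q < 1 \<and> (\<forall>\<Omega> \<T> N \<phi> i j P Q \<nu> n.
    mesh_configuration \<theta> c1 c2 c3 c4 cA Distant \<Omega> \<T> N \<phi> i j P Q \<nu> \<and> 1 \<le> n \<longrightarrow>
    integrand_error Distant n s (\<phi> i) (\<phi> j) P Q \<nu> \<le> C * mesh_size \<T> powr (3 - 2 * s) * q ^ n)"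
proof -
  obtain \<kappa> \<beta> where \<kappa>: "0 < \<kappa>" "0 < \<beta>"
    and nd: "\<And>c3 cA star \<Omega> \<T> N \<phi> i j P Q \<nu>. mesh_configuration \<theta> c1 c2 c3 c4 cA star \<Omega> \<T> N \<phi> i j P Q \<nu> \<Longrightarrow>
       nondegenerate_pair \<kappa> \<beta> (mesh_size \<T>) P Q"
    using mesh_nondegenerate_pair[OF assms(1-3,5)] by blast
  show ?thesis
  proof (rule cube_approximable_kernel[OF \<kappa>(1) assms(4), where 'k = 5 and s = s], goal_cases)
    case (1 C q)
    note kern = 1(4)
    have "integrand_error Distant n s (\<phi> i) (\<phi> j) P Q \<nu> \<le> (2 * C) * mesh_size \<T> powr (3 - 2 * s) * q ^ n"
      if mc: "mesh_configuration \<theta> c1 c2 c3 c4 cA Distant \<Omega> \<T> N \<phi> i j P Q \<nu>" and n: "1 \<le> n"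
      for \<Omega> \<T> N \<phi> i j P Q \<nu> n
    proof -
      let ?h = "mesh_size \<T>"
      let ?x = "\<lambda>\<eta>::real^5. vector [\<eta>$1, \<eta>$1 * \<eta>$2 * \<eta>$3, \<eta>$1 * \<eta>$2 * (1 - \<eta>$3)] :: real^3"
      let ?y = "\<lambda>\<eta>::real^5. vector [\<eta>$4, \<eta>$4 * \<eta>$5] :: real^2"
      have X: "tet_map P (?x \<eta>) \<in> conv P" if "\<eta> \<in> cbox 0 1" for \<eta>
        using cube_coord[OF that]
        by (intro tet_map_in_conv) (auto simp: mult_left_le mult_left_mono algebra_simps)
      have Y: "tri_map Q (?y \<eta>) \<in> conv Q" if "\<eta> \<in> cbox 0 1" for \<eta>
        using cube_coord[OF that]
        by (intro tri_map_in_conv) (auto simp: mult_left_le)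
      have "cube_approximable n (C * ?h powr (3 - 2 * s) * q ^ n)
          (integrand_D (kernel2 s (\<phi> i) (\<phi> j) P Q \<nu>))"
        unfolding integrand_D_def
      proof (rule kern[OF nondegenerate_pairD[OF nd[OF mc]] mesh_configuration_kernel(1)[OF mc]])
        show "bounded_affine_at (\<phi> i) P (?x ` cbox 0 1)" "bounded_affine_at (\<phi> j) P (?x ` cbox 0 1)"
          using X by (auto intro!: mesh_configuration_kernel(4,5)[OF mc])
        show "c3 * ?h \<le> norm (tri_map Q (?y \<eta>) - tet_map P (?x \<eta>))" if "\<eta> \<in> cbox 0 1" for \<eta>
          using setdist_le_dist[OF X[OF that] Y[OF that]] mc
          by (auto simp: mesh_configuration_def dist_norm norm_minus_commute)
      qed ((rule unit_poly_cube_poly, (rule cube_poly_intros)+, simp)+)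
      from quadrature_error_cube_approximable[OF this n] show ?thesis
        by (simp add: mult_ac)
    qed
    then show ?case
      using 1(1-3) by (intro exI[of _ "2 * C"] exI[of _ q]) auto
  qed
qed

lemma vertex_error:
  assumes "0 < \<theta>" "0 < c1" "0 < c2" "0 < c4" "0 < cA"
  shows "\<exists>C q. 0 < C \<and> 0 < q \<and> q < 1 \<and> (\<forall>\<Omega> \<T> N \<phi> i j P Q \<nu> n.
    mesh_configuration \<theta> c1 c2 c3 c4 cA Vertex \<Omega> \<T> N \<phi> i j P Q \<nu> \<and> 1 \<le> n \<longrightarrow>
    integrand_error Vertex n s (\<phi> i) (\<phi> j) P Q \<nu> \<le> C * mesh_size \<T> powr (3 - 2 * s) * q ^ n)"
proof -
  obtain \<kappa> \<beta> where \<kappa>: "0 < \<kappa>" "0 < \<beta>"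
    and nd: "\<And>c3 cA star \<Omega> \<T> N \<phi> i j P Q \<nu>. mesh_configuration \<theta> c1 c2 c3 c4 cA star \<Omega> \<T> N \<phi> i j P Q \<nu> \<Longrightarrow>
       nondegenerate_pair \<kappa> \<beta> (mesh_size \<T>) P Q"
    using mesh_nondegenerate_pair[OF assms(1-4)] by blast
  have m: "0 < cA * \<beta>" using \<kappa> assms by simp
  show ?thesis
  proof (rule cube_approximable_kernel[OF \<kappa>(1) m, where 'k = 4 and s = s], goal_cases)
    case (1 C q)
    note kern = 1(4)
    have "integrand_error Vertex n s (\<phi> i) (\<phi> j) P Q \<nu> \<le> (4 * C) * mesh_size \<T> powr (3 - 2 * s) * q ^ n"
      if mc: "mesh_configuration \<theta> c1 c2 c3 c4 cA Vertex \<Omega> \<T> N \<phi> i j P Q \<nu>" and n: "1 \<le> n"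
      for \<Omega> \<T> N \<phi> i j P Q \<nu> n
    proof -
      let ?h = "mesh_size \<T>"
      let ?E = "C * ?h powr (3 - 2 * s) * q ^ n"
      have PQ: "P$1 = Q$1" and int: "conv P \<inter> conv Q = {P$1}"
        using mc by (auto simp: mesh_configuration_def)
      have "\<forall>x\<in>conv P. \<forall>y\<in>conv Q. cA * (dist x (P$1) + dist (P$1) y) \<le> dist x y"
        using mc int by (auto simp: mesh_configuration_def geometric_assumption_def)
      then have dist: "cA * (dist x (P$1) + dist (P$1) y) \<le> dist x y" if "x \<in> conv P" "y \<in> conv Q" for x y
        using that by blast
      note bound = vertex_distance_bound[OF nd[OF mc] assms(5) PQ dist]
      note kern' = kern[OF nondegenerate_pairD[OF nd[OF mc]] mesh_configuration_kernel(1)[OF mc]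
          _ _ _ _ _ _ mesh_configuration_kernel(2,3)[OF mc]]
      have "cube_approximable n (?E + ?E) (integrand_V (kernel2 s
          (affine_extension (\<phi> i) (conv P)) (affine_extension (\<phi> j) (conv P)) P Q \<nu>))"
        unfolding integrand_V_def
      \<comment> \<open>Each term leaves seven goals, the last of which is the distance bound. The
        first term has its tetrahedron point, the second its panel point, opposite to the common
        vertex.\<close>
      proof (intro cube_approximable_add kern', goal_cases)
        case (7 \<eta>)
        show ?case
          using cube_coord[OF 7] by (intro bound) (auto simp: mult_left_le mult_left_mono algebra_simps)
      next
        case (14 \<eta>)
        show ?case
          using cube_coord[OF 14] by (intro bound) (auto simp: mult_left_le mult_left_mono algebra_simps)
      qed ((rule unit_poly_const, simp) | (rule unit_poly_cube_poly, (rule cube_poly_intros)+, simp))+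
      from quadrature_error_cube_approximable[OF this n] show ?thesis
        by (simp add: mult_ac)
    qed
    then show ?case
      using 1(1-3) by (intro exI[of _ "4 * C"] exI[of _ q]) auto
  qed
qed

text \<open>The edge clause of the geometric assumption asks for a common edge of both elements,
  whereas the configuration only names a segment.\<close>

lemma edge_of_conv:
  fixes P :: "real^3^'k"
  assumes "\<not> affine_dependent (range (($) P))" "P$k \<noteq> P$l"
  shows "closed_segment (P$k) (P$l) edge_of conv P"
proof -
  have "{P$k, P$l} \<subseteq> range (($) P)" by auto
  then have "closed_segment (P$k) (P$l) face_of conv P"
    unfolding conv_def segment_convex_hull face_of_convex_hull_affine_independent[OF assms(1)]
    by blast
  moreover have "aff_dim (closed_segment (P$k) (P$l)) = 1"
    unfolding segment_convex_hull aff_dim_convex_hull using assms(2) by (simp add: aff_dim_2)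
  ultimately show ?thesis
    by (simp add: edge_of_def)
qed

lemma edge_error:
  assumes "0 < \<theta>" "0 < c1" "0 < c2" "0 < c4" "0 < cA"
  shows "\<exists>C q. 0 < C \<and> 0 < q \<and> q < 1 \<and> (\<forall>\<Omega> \<T> N \<phi> i j P Q \<nu> n.
    mesh_configuration \<theta> c1 c2 c3 c4 cA Edge \<Omega> \<T> N \<phi> i j P Q \<nu> \<and> 1 \<le> n \<longrightarrow>
    integrand_error Edge n s (\<phi> i) (\<phi> j) P Q \<nu> \<le> C * mesh_size \<T> powr (3 - 2 * s) * q ^ n)"
proof -
  obtain \<kappa> \<beta> where \<kappa>: "0 < \<kappa>" "0 < \<beta>"
    and nd: "\<And>c3 cA star \<Omega> \<T> N \<phi> i j P Q \<nu>. mesh_configuration \<theta> c1 c2 c3 c4 cA star \<Omega> \<T> N \<phi> i j P Q \<nu> \<Longrightarrow>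
       nondegenerate_pair \<kappa> \<beta> (mesh_size \<T>) P Q"
    using mesh_nondegenerate_pair[OF assms(1-4)] by blast
  have m: "0 < 1 / (1 / \<beta> + 3 * \<kappa> / (cA * \<beta>\<^sup>2) + 3 / (cA * \<beta>))"
    using \<kappa> assms(5) by (intro divide_pos_pos add_pos_pos) auto
  show ?thesis
  proof (rule cube_approximable_kernel[OF \<kappa>(1) m, where 'k = 3 and s = s], goal_cases)
    case (1 C q)
    note kern = 1(4)
    have "integrand_error Edge n s (\<phi> i) (\<phi> j) P Q \<nu> \<le> (8 * C) * mesh_size \<T> powr (3 - 2 * s) * q ^ n"
      if mc: "mesh_configuration \<theta> c1 c2 c3 c4 cA Edge \<Omega> \<T> N \<phi> i j P Q \<nu>" and n: "1 \<le> n"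
      for \<Omega> \<T> N \<phi> i j P Q \<nu> n
    proof -
      let ?h = "mesh_size \<T>"
      let ?E = "C * ?h powr (3 - 2 * s) * q ^ n"
      have PQ: "P$1 = Q$1" "P$2 = Q$2" and int: "conv P \<inter> conv Q = closed_segment (P$1) (P$2)"
        and T: "conv P \<in> \<T>" "conv Q \<in> panels \<T>" "3 simplex (conv P)" "geometric_assumption cA \<T>"
        using mc by (auto simp: mesh_configuration_def regular_partition_def)
      obtain t where t: "conv Q facet_of t" "3 simplex t"
        using mc by (auto simp: mesh_configuration_def regular_partition_def panels_def)
      have "P$1 \<noteq> P$2"
        using simplex_conv_vertices(2)[OF T(3)] by (auto simp: inj_eq)
      then have "closed_segment (P$1) (P$2) edge_of conv P" "closed_segment (P$1) (P$2) edge_of conv Q"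
        using edge_of_conv[OF simplex_conv_vertices(1)[OF T(3)], of 1 2]
          edge_of_conv[OF panel_conv_vertices(1)[OF t(2,1)], of 1 2] PQ by auto
      then have dist: "\<exists>p\<in>closed_segment (P$1) (P$2). cA * (dist x p + dist p y) \<le> dist x y"
        if "x \<in> conv P" "y \<in> conv Q" for x y
        using T(1,2,4) int that unfolding geometric_assumption_def by metis
      note bound = edge_distance_bound[OF nd[OF mc] \<kappa>(2,1) assms(5) PQ dist]
      note kern' = kern[OF nondegenerate_pairD[OF nd[OF mc]] mesh_configuration_kernel(1)[OF mc]
          _ _ _ _ _ _ mesh_configuration_kernel(2,3)[OF mc]]
      have lower: "1 / (1 / \<beta> + 3 * \<kappa> / (cA * \<beta>\<^sup>2) + 3 / (cA * \<beta>)) * ?h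
          \<le> norm (tri_map Q (vector [y1, y2]) - tet_map P (vector [x1, x2, x3]))"
        if "x1 \<le> 0" "0 \<le> x2" "0 \<le> x3" "x2 + x3 \<le> 1 + x1" "y1 \<le> 0" "0 \<le> y2" "y2 \<le> 1 + y1"
          "1 \<le> \<bar>x1 - y1\<bar> + x2 + x3 + y2" for x1 x2 x3 y1 y2
        using that by (intro bound) auto
      \<comment> \<open>Products of coordinates become atoms with these bounds, so that the
        conditions of \<open>lower\<close> are linear.\<close>
      have prod: "(0 \<le> \<eta>$1 \<and> \<eta>$1 \<le> 1 \<and> 0 \<le> \<eta>$2 \<and> \<eta>$2 \<le> 1 \<and> 0 \<le> \<eta>$3 \<and> \<eta>$3 \<le> 1) \<and>
          (0 \<le> \<eta>$2 * \<eta>$3 \<and> \<eta>$2 * \<eta>$3 \<le> \<eta>$2) \<and> (0 \<le> \<eta>$1 * \<eta>$2 \<and> \<eta>$1 * \<eta>$2 \<le> \<eta>$1) \<and>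
          0 \<le> \<eta>$1 * (\<eta>$2 * \<eta>$3) \<and> \<eta>$1 * (\<eta>$2 * \<eta>$3) \<le> \<eta>$1 * \<eta>$2"
        if "\<eta> \<in> cbox 0 1" for \<eta> :: "real^3"
        using cube_coord[OF that] by (auto simp: mult_left_le mult_left_mono)
      \<comment> \<open>Four terms; the relative coordinates of each satisfy the normalization in
        \<open>lower\<close>. The factor 2 from the quadrature error makes the constant
        \<open>8 * C\<close>.\<close>
      have "cube_approximable n (?E + ?E + ?E + ?E) (integrand_E (kernel2 s
          (affine_extension (\<phi> i) (conv P)) (affine_extension (\<phi> j) (conv P)) P Q \<nu>))"
        unfolding integrand_E_def minus_mult_left[symmetric]
        by (intro cube_approximable_add kern')
          ((rule unit_poly_const, simp) | (rule unit_poly_cube_poly, (rule cube_poly_intros)+, simp)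
          | (rule unit_poly_minus_cube_poly, (rule cube_poly_intros)+, simp)
          | (drule prod, rule lower; simp add: algebra_simps))+
      from quadrature_error_cube_approximable[OF this n] show ?thesis
        by (simp add: mult_ac)
    qed
    then show ?case
      using 1(1-3) by (intro exI[of _ "8 * C"] exI[of _ q]) auto
  qed
qed

lemma face_error:
  assumes "0 < \<theta>" "0 < c1" "0 < c2" "0 < c4"
  shows "\<exists>C q. 0 < C \<and> 0 < q \<and> q < 1 \<and> (\<forall>\<Omega> \<T> N \<phi> i j P Q \<nu> n.
    mesh_configuration \<theta> c1 c2 c3 c4 cA Face \<Omega> \<T> N \<phi> i j P Q \<nu> \<and> 1 \<le> n \<longrightarrow>
    integrand_error Face n s (\<phi> i) (\<phi> j) P Q \<nu> \<le> C * mesh_size \<T> powr (3 - 2 * s) * q ^ n)"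
proof -
  obtain \<kappa> \<beta> where \<kappa>: "0 < \<kappa>" "0 < \<beta>"
    and nd: "\<And>c3 cA star \<Omega> \<T> N \<phi> i j P Q \<nu>. mesh_configuration \<theta> c1 c2 c3 c4 cA star \<Omega> \<T> N \<phi> i j P Q \<nu> \<Longrightarrow>
       nondegenerate_pair \<kappa> \<beta> (mesh_size \<T>) P Q"
    using mesh_nondegenerate_pair[OF assms(1-4)] by blast
  have m: "0 < \<beta> / 3"
    using \<kappa> by simp
  show ?thesis
  proof (rule cube_approximable_kernel[OF \<kappa>(1) m, where 'k = 2 and s = s], goal_cases)
    case (1 C q)
    note kern = 1(4)
    have "integrand_error Face n s (\<phi> i) (\<phi> j) P Q \<nu> \<le> (18 * C) * mesh_size \<T> powr (3 - 2 * s) * q ^ n"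
      if mc: "mesh_configuration \<theta> c1 c2 c3 c4 cA Face \<Omega> \<T> N \<phi> i j P Q \<nu>" and n: "1 \<le> n"
      for \<Omega> \<T> N \<phi> i j P Q \<nu> n
    proof -
      let ?h = "mesh_size \<T>"
      let ?E = "C * ?h powr (3 - 2 * s) * q ^ n"
      have PQ: "P$1 = Q$1" "P$2 = Q$2" "P$3 = Q$3"
        using mc by (auto simp: mesh_configuration_def)
      note kern' = kern[OF nondegenerate_pairD[OF nd[OF mc]] mesh_configuration_kernel(1)[OF mc]
          _ _ _ _ _ _ mesh_configuration_kernel(2,3)[OF mc]]
      have lower: "\<beta> / 3 * ?h \<le> norm (tri_map Q (vector [y1, y2]) - tet_map P (vector [x1, x2, x3]))"
        if "1 \<le> \<bar>x1 - y1\<bar> + \<bar>x2 - y2\<bar> + \<bar>x3\<bar>" for x1 x2 x3 y1 y2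
        using face_distance_bound[OF nd[OF mc] \<kappa>(2) PQ, of "vector [x1, x2, x3]" "vector [y1, y2]"] that
        by simp
      have prod: "0 \<le> \<eta>$1 \<and> \<eta>$1 \<le> 1 \<and> 0 \<le> \<eta>$2 \<and> \<eta>$2 \<le> 1 \<and> 0 \<le> \<eta>$1 * \<eta>$2 \<and> \<eta>$1 * \<eta>$2 \<le> \<eta>$1"
        if "\<eta> \<in> cbox 0 1" for \<eta> :: "real^2"
        using cube_coord[OF that] by (auto simp: mult_left_le)
      \<comment> \<open>Nine terms, hence \<open>18 * C\<close>. The last one has no Jacobian factor
        and needs the instance with \<open>J\<close> equal to 1.\<close>
      have "cube_approximable n (?E + ?E + ?E + ?E + ?E + ?E + ?E + ?E + ?E) (integrand_F (kernel2 s
          (affine_extension (\<phi> i) (conv P)) (affine_extension (\<phi> j) (conv P)) P Q \<nu>))"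
        unfolding integrand_F_def minus_mult_left[symmetric]
        by (intro cube_approximable_add kern' kern'[where J = "\<lambda>\<eta>. 1", unfolded mult_1_right])
          ((rule unit_poly_const, simp) | (rule unit_poly_cube_poly, (rule cube_poly_intros)+, simp)
          | (rule unit_poly_minus_cube_poly, (rule cube_poly_intros)+, simp)
          | (drule prod, rule lower; simp add: algebra_simps))+
      from quadrature_error_cube_approximable[OF this n] show ?thesis
        by (simp add: mult_ac)
    qed
    then show ?case
      using 1(1-3) by (intro exI[of _ "18 * C"] exI[of _ q]) auto
  qed
qed

theorem theorem4p20:
  fixes s \<theta> c1 c2 c3 c4 cA :: real and \<Omega> :: "(real^3) set" and star :: interaction
  assumes "0 < s" "s < 1"
    and "lipschitz_domain \<Omega>"
    and "0 < \<theta>" "0 < c1" "0 < c2" "0 < c3" "0 < c4" "0 < cA"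
  shows "\<exists>C \<rho>. 0 < C \<and> 1 / 2 < \<rho> \<and>
    (\<forall>\<T> N \<phi> i j P Q \<nu> n.
       regular_partition \<Omega> \<T> \<and> shape_regular \<theta> \<T> \<and> quasi_uniform c1 c2 \<T> \<and>
       geometric_assumption cA \<T> \<and>
       nodal_basis \<Omega> \<T> N \<phi> \<and> i \<in> {1..N} \<and> j \<in> {1..N} \<and>
       conv P \<in> \<T> \<and> conv Q \<in> panels \<T> \<and>
       conv Q \<subseteq> frontier (supp (\<phi> i) \<union> supp (\<phi> j)) \<and>
       unit_normal (conv Q) \<nu> \<and>
       configuration star c3 c4 (mesh_size \<T>) P Q \<and>
       1 \<le> n \<longrightarrow>
       integrand_error star n s (\<phi> i) (\<phi> j) P Q \<nu>
         \<le> C * mesh_size \<T> powr (3 - 2 * s) * (2 * \<rho>) powi (- 2 * int n))"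
proof -
  have "\<exists>C q. 0 < C \<and> 0 < q \<and> q < 1 \<and> (\<forall>\<Omega> \<T> N \<phi> i j P Q \<nu> n.
    mesh_configuration \<theta> c1 c2 c3 c4 cA star \<Omega> \<T> N \<phi> i j P Q \<nu> \<and> 1 \<le> n \<longrightarrow>
    integrand_error star n s (\<phi> i) (\<phi> j) P Q \<nu> \<le> C * mesh_size \<T> powr (3 - 2 * s) * q ^ n)"
    using distant_error[OF assms(4-8)] vertex_error[OF assms(4-6,8,9)]
      edge_error[OF assms(4-6,8,9)] face_error[OF assms(4-6,8)]
    by (cases star) (simp_all only:)
  then obtain C q where C: "0 < C" and q: "0 < q" "q < 1"
    and err: "\<forall>\<Omega> \<T> N \<phi> i j P Q \<nu> n. mesh_configuration \<theta> c1 c2 c3 c4 cA star \<Omega> \<T> N \<phi> i j P Q \<nu> \<and> 1 \<le> n \<longrightarrow>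
      integrand_error star n s (\<phi> i) (\<phi> j) P Q \<nu> \<le> C * mesh_size \<T> powr (3 - 2 * s) * q ^ n"
    by (elim exE conjE) (rule that)
  \<comment> \<open>The solution of \<open>(2 * \<rho>)^(-2) = q\<close>; it exceeds 1/2 exactly
    because \<open>q < 1\<close>.\<close>
  define \<rho> where "\<rho> = 1 / (2 * sqrt q)"
  have "1 / 2 < \<rho>"
    using q by (simp add: \<rho>_def field_simps)
  moreover have "(2 * \<rho>) powi (- 2 * int n) = q ^ n" for n
  proof -
    have "- 2 * int n = - int (2 * n)" by simp
    then have "(2 * \<rho>) powi (- 2 * int n) = inverse ((2 * \<rho>) ^ (2 * n))"
      by (simp only: power_int_minus power_int_of_nat)
    also have "\<dots> = q ^ n"
      using q by (simp add: \<rho>_def power_mult power_divide)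
    finally show ?thesis .
  qed
  ultimately show ?thesis
    using C err by (intro exI[of _ C] exI[of _ \<rho>]) (auto simp: mesh_configuration_def)
qed

end
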